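(* The careful cooperative rational synthesis problem (given a multi-player arena $\mathcal{G}$, a multi-dimensional cost function $\overline{\mathsf{cost}}$, objectives $\mathsf{Obj}_1,\dots,\mathsf{Obj}_n$ of the players and a global specification $\mathsf{Obj}$, decide whether there exists a strategy profile that is a solution) is undecidable. It remains undecidable when restricted to instances with two players ($n=2$), two resources ($d=2$), and in which $\mathsf{Obj}_1$, $\mathsf{Obj}_2$ and $\mathsf{Obj}$ are reachability objectives.
   Context: **Arena.** A multi-player arena is a tuple $\mathcal{G}=\langle \mathsf{S},(\mathsf{S}_1\uplus\dots\uplus\mathsf{S}_n),s_0,\mathsf{P},\mathsf{E},\mathsf{AP},\ell\rangle$ where $\mathsf{S}$ is a finite set of states, partitioned into $\mathsf{S}_1,\dots,\mathsf{S}_n$ ($\mathsf{S}_i$ is the set of states controlled by player $i$), $s_0\in\mathsf{S}$ is the initial state, $\mathsf{P}=\{1,\dots,n\}$ is the set of players, $\mathsf{E}\subseteq\mathsf{S}\times\mathsf{S}$ is the edge relation, $\mathsf{AP}$ is a set of atomic propositions and $\ell:\mathsf{S}\to 2^{\mathsf{AP}}$ is a labeling. Every state has at least one outgoing edge. **Plays, strategies.** A play is an infinite sequence $s_0s_1s_2\dots$ of states starting at the initial state with $(s_j,s_{j+1})\in\mathsf{E}$ for all $j\ge 0$; $\mathsf{Plys}(\mathcal{G})$ is the set of plays. A history is a nonempty finite prefix of a play. A strategy for player $i$ is a function $\sigma_i$ mapping each history whose last state $s$ is in $\mathsf{S}_i$ to a state $s'$ with $(s,s')\in\mathsf{E}$.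 A strategy profile is a tuple $\overline{\sigma}=\langle\sigma_1,\dots,\sigma_n\rangle$, one strategy per player; $\langle\overline{\sigma}\rangle$ denotes its outcome, the unique play in which each next state is the one chosen by the strategy of the player controlling the current state. $\langle\overline{\sigma}_{-i},\sigma_i'\rangle$ is the profile obtained from $\overline{\sigma}$ by replacing $\sigma_i$ by $\sigma_i'$; it is also used to denote the outcome of that profile. **Costs.** A $d$-dimensional cost function is $\overline{\mathsf{cost}}:\mathsf{E}\to\mathbb{Z}^d$ (integers encoded in binary), where $d$ is the number of resources. For a history $h=s_0s_1\dots s_m$, $\overline{\mathsf{cost}}(h)=\sum_{j=0}^{m-1}\overline{\mathsf{cost}}(s_j,s_{j+1})$ (so it is $(0,\dots,0)$ for $h=s_0$). $\mathsf{MultiEnergy}(\mathcal{G})$ is the set of plays all of whose finite prefixes $h$ satisfy $\overline{\mathsf{cost}}(h)\ge(0,\dots,0)$ componentwise. **Objectives.** An objective is a set of plays (finitely presented, e.g. by an LTL formula over $\mathsf{AP}$ interpreted on the labels of the play). A reachability objective is the set of plays that visit some state of a given set $T\subseteq\mathsf{S}$. **Solution.** Given objectives $\mathsf{Obj}_1,\dots,\mathsf{Obj}_n$ of the players and a global specification $\mathsf{Obj}$, a profile $\overline{\sigma}$ is a solution to careful cooperative rational synthesis if $\langle\overline{\sigma}\rangle\in\mathsf{MultiEnergy}(\mathcal{G})\cap\mathsf{Obj}$ and, for every player $i$ and every strategy $\sigma_i'$ of player $i$: $\langle\overline{\sigma}_{-i},\sigma_i'\rangle\in\mathsf{Obj}_i\cap\mathsf{MultiEnergy}(\mathcal{G})$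 implies $\langle\overline{\sigma}\rangle\in\mathsf{Obj}_i$. *)

theory Defs
  imports Main "HOL-Library.Nat_Bijection"
begin

section \<open>Multi-player arenas\<close>

record ('s, 'p) arena =
  states :: "'s set"
  num_players :: nat
  ctrl :: "nat \<Rightarrow> 's set"
  init :: 's
  edges :: "('s \<times> 's) set"
  props :: "'p set"
  label :: "'s \<Rightarrow> 'p set"

abbreviation players :: "('s, 'p, 'm) arena_scheme \<Rightarrow> nat set" where
  "players G \<equiv> {1..num_players G}"

definition wf_arena :: "('s, 'p, 'm) arena_scheme \<Rightarrow> bool" where
  "wf_arena G \<longleftrightarrow>
     finite (states G) \<and>
     (\<Union>i\<in>players G. ctrl G i) = states G \<and>
     (\<forall>i\<in>players G. \<forall>j\<in>players G. i \<noteq> j \<longrightarrow> ctrl G i \<inter> ctrl G j = {}) \<and>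
     init G \<in> states G \<and>
     edges G \<subseteq> states G \<times> states G \<and>
     (\<forall>s\<in>states G. \<exists>t. (s, t) \<in> edges G) \<and>
     (\<forall>s\<in>states G. label G s \<subseteq> props G)"

type_synonym 's play = "nat \<Rightarrow> 's"
type_synonym 's strategy = "'s list \<Rightarrow> 's"
type_synonym 's profile = "nat \<Rightarrow> 's strategy"

definition plays :: "('s, 'p, 'm) arena_scheme \<Rightarrow> 's play set" where
  "plays G = {\<rho>. \<rho> 0 = init G \<and> (\<forall>j. (\<rho> j, \<rho> (Suc j)) \<in> edges G)}"

text \<open>The nonempty prefix \<open>\<rho> 0, \<dots>, \<rho> m\<close>.\<close>

definition prefix :: "'s play \<Rightarrow> nat \<Rightarrow> 's list" where
  "prefix \<rho> m = map \<rho> [0..<Suc m]"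

definition histories :: "('s, 'p, 'm) arena_scheme \<Rightarrow> 's list set" where
  "histories G = {prefix \<rho> m | \<rho> m. \<rho> \<in> plays G}"

text \<open>Strategies are total functions on lists; only their values on histories ending in a state
  of the player matter.\<close>

definition is_strategy :: "('s, 'p, 'm) arena_scheme \<Rightarrow> nat \<Rightarrow> 's strategy \<Rightarrow> bool" where
  "is_strategy G i \<tau> \<longleftrightarrow>
     (\<forall>h\<in>histories G. last h \<in> ctrl G i \<longrightarrow> (last h, \<tau> h) \<in> edges G)"

definition is_profile :: "('s, 'p, 'm) arena_scheme \<Rightarrow> 's profile \<Rightarrow> bool" where
  "is_profile G \<sigma> \<longleftrightarrow> (\<forall>i\<in>players G. is_strategy G i (\<sigma> i))"

definition follows :: "('s, 'p, 'm) arena_scheme \<Rightarrow> 's profile \<Rightarrow> 's play \<Rightarrow> bool" where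
  "follows G \<sigma> \<rho> \<longleftrightarrow>
     (\<forall>j. \<forall>i\<in>players G. \<rho> j \<in> ctrl G i \<longrightarrow> \<rho> (Suc j) = \<sigma> i (prefix \<rho> j))"

definition outcome :: "('s, 'p, 'm) arena_scheme \<Rightarrow> 's profile \<Rightarrow> 's play" where
  "outcome G \<sigma> = (THE \<rho>. \<rho> \<in> plays G \<and> follows G \<sigma> \<rho>)"

lemma prefix_Suc: "prefix \<rho> (Suc m) = prefix \<rho> m @ [\<rho> (Suc m)]"
  by (simp add: prefix_def)

lemma outcome_ex1:
  assumes wf: "wf_arena G" and prof: "is_profile G \<sigma>"
  shows "\<exists>!\<rho>. \<rho> \<in> plays G \<and> follows G \<sigma> \<rho>"
proof (rule ex_ex1I)
  define own where "own s = (SOME i. i \<in> players G \<and> s \<in> ctrl G i)" for s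
  define H where "H = rec_nat [init G] (\<lambda>_ h. h @ [\<sigma> (own (last h)) h])"
  define \<rho> where "\<rho> j = last (H j)" for j
  have H0: "H 0 = [init G]" and HS: "H (Suc j) = H j @ [\<sigma> (own (last (H j))) (H j)]" for j
    by (simp_all add: H_def)
  have pre: "prefix \<rho> j = H j" for j
  proof (induction j)
    case 0 show ?case by (simp add: prefix_def \<rho>_def H0)
  next
    case (Suc j) then show ?case by (simp add: prefix_Suc \<rho>_def HS)
  qed
  have own: "own s \<in> players G \<and> s \<in> ctrl G (own s)" if "s \<in> states G" for s
  proof -
    have "\<exists>i. i \<in> players G \<and> s \<in> ctrl G i" using wf that unfolding wf_arena_def by blast
    then show ?thesis unfolding own_def by (rule someI_ex)
  qed
  have own_eq: "own s = i" if "i \<in> players G" "s \<in> ctrl G i" for s i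
  proof -
    have "s \<in> states G" using wf that unfolding wf_arena_def by blast
    then show ?thesis using own[of s] wf that unfolding wf_arena_def by blast
  qed
  obtain nxt where nxt: "\<And>s. s \<in> states G \<Longrightarrow> (s, nxt s) \<in> edges G"
    using wf unfolding wf_arena_def by metis
  have step: "(\<rho> j, \<rho> (Suc j)) \<in> edges G" for j
  proof (induction j rule: less_induct)
    case (less j)
    have st: "\<rho> j \<in> states G"
    proof (cases j)
      case 0 then show ?thesis using wf by (simp add: \<rho>_def H0 wf_arena_def)
    next
      case (Suc k)
      then show ?thesis using less[of k] wf by (auto simp: wf_arena_def)
    qed
    define \<rho>' where "\<rho>' m = (if m \<le> j then \<rho> m else (nxt ^^ (m - j)) (\<rho> j))" for m
    have it: "(nxt ^^ k) (\<rho> j) \<in> states G" for k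
    proof (induction k)
      case 0 show ?case using st by simp
    next
      case (Suc k) then show ?case using nxt[OF Suc] wf by (auto simp: wf_arena_def)
    qed
    have "\<rho>' \<in> plays G"
      unfolding plays_def
    proof (intro CollectI conjI allI)
      show "\<rho>' 0 = init G" by (simp add: \<rho>'_def \<rho>_def H0)
      fix m show "(\<rho>' m, \<rho>' (Suc m)) \<in> edges G"
      proof (cases "m < j")
        case True then show ?thesis using less[of m] by (simp add: \<rho>'_def)
      next
        case False
        then have "\<rho>' m = (nxt ^^ (m - j)) (\<rho> j)" "\<rho>' (Suc m) = nxt ((nxt ^^ (m - j)) (\<rho> j))"
          by (auto simp: \<rho>'_def Suc_diff_le)
        then show ?thesis using nxt[OF it] by simp
      qed
    qed
    moreover have "prefix \<rho>' j = prefix \<rho> j" by (auto simp: prefix_def \<rho>'_def)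
    ultimately have "prefix \<rho> j \<in> histories G" unfolding histories_def by (metis (mono_tags) mem_Collect_eq)
    then have "H j \<in> histories G" by (simp add: pre)
    then have "(last (H j), \<sigma> (own (\<rho> j)) (H j)) \<in> edges G"
      using prof own[OF st] unfolding is_profile_def is_strategy_def \<rho>_def by blast
    then show ?case by (simp add: \<rho>_def HS)
  qed
  have "\<rho> \<in> plays G" using step by (simp add: plays_def) (simp add: \<rho>_def H0)
  moreover have "follows G \<sigma> \<rho>"
    unfolding follows_def
  proof (intro allI ballI impI)
    fix j i assume "i \<in> players G" "\<rho> j \<in> ctrl G i"
    then have "own (last (H j)) = i" using own_eq by (simp add: \<rho>_def)
    then show "\<rho> (Suc j) = \<sigma> i (prefix \<rho> j)" by (simp add: pre) (simp add: \<rho>_def HS)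
  qed
  ultimately show "\<exists>\<rho>. \<rho> \<in> plays G \<and> follows G \<sigma> \<rho>" by blast
next
  fix \<rho> \<rho>' assume a: "\<rho> \<in> plays G \<and> follows G \<sigma> \<rho>" and b: "\<rho>' \<in> plays G \<and> follows G \<sigma> \<rho>'"
  have "prefix \<rho> m = prefix \<rho>' m \<and> \<rho> m = \<rho>' m" for m
  proof (induction m)
    case 0 show ?case using a b by (simp add: prefix_def plays_def)
  next
    case (Suc m)
    have "(\<rho> m, \<rho> (Suc m)) \<in> edges G" using a by (simp add: plays_def)
    then have "\<rho> m \<in> states G" using wf unfolding wf_arena_def by blast
    then obtain i where "i \<in> players G" "\<rho> m \<in> ctrl G i"
      using wf unfolding wf_arena_def by blast
    then have "\<rho> (Suc m) = \<rho>' (Suc m)" using a b Suc unfolding follows_def by metis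
    then show ?case using Suc by (simp add: prefix_Suc)
  qed
  then show "\<rho> = \<rho>'" by blast
qed


section \<open>Costs, objectives and solutions\<close>

text \<open>Resources are numbered from 0; of a vector-valued cost function only the components
  below the dimension \<open>d\<close> matter.\<close>

type_synonym 's cost_fun = "'s \<times> 's \<Rightarrow> nat \<Rightarrow> int"

definition history_cost :: "'s cost_fun \<Rightarrow> 's list \<Rightarrow> nat \<Rightarrow> int" where
  "history_cost c h k = (\<Sum>j<length h - 1. c (h ! j, h ! Suc j) k)"

definition multi_energy ::
    "('s, 'p, 'm) arena_scheme \<Rightarrow> nat \<Rightarrow> 's cost_fun \<Rightarrow> 's play set" where
  "multi_energy G d c = {\<rho> \<in> plays G. \<forall>m. \<forall>k<d. history_cost c (prefix \<rho> m) k \<ge> 0}"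

definition reach :: "('s, 'p, 'm) arena_scheme \<Rightarrow> 's set \<Rightarrow> 's play set" where
  "reach G T = {\<rho> \<in> plays G. \<exists>j. \<rho> j \<in> T}"

datatype 'p ltl =
    TrueL
  | Atom 'p
  | Neg "'p ltl"
  | Conj "'p ltl" "'p ltl"
  | Next "'p ltl"
  | Until "'p ltl" "'p ltl"

primrec ltl_holds :: "(nat \<Rightarrow> 'p set) \<Rightarrow> nat \<Rightarrow> 'p ltl \<Rightarrow> bool" where
  "ltl_holds w j TrueL \<longleftrightarrow> True"
| "ltl_holds w j (Atom p) \<longleftrightarrow> p \<in> w j"
| "ltl_holds w j (Neg \<phi>) \<longleftrightarrow> \<not> ltl_holds w j \<phi>"
| "ltl_holds w j (Conj \<phi> \<psi>) \<longleftrightarrow> ltl_holds w j \<phi> \<and> ltl_holds w j \<psi>"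
| "ltl_holds w j (Next \<phi>) \<longleftrightarrow> ltl_holds w (Suc j) \<phi>"
| "ltl_holds w j (Until \<phi> \<psi>) \<longleftrightarrow>
     (\<exists>k\<ge>j. ltl_holds w k \<psi> \<and> (\<forall>m. j \<le> m \<and> m < k \<longrightarrow> ltl_holds w m \<phi>))"

definition ltl_objective :: "('s, 'p, 'm) arena_scheme \<Rightarrow> 'p ltl \<Rightarrow> 's play set" where
  "ltl_objective G \<phi> = {\<rho> \<in> plays G. ltl_holds (\<lambda>j. label G (\<rho> j)) 0 \<phi>}"

definition is_solution ::
    "('s, 'p, 'm) arena_scheme \<Rightarrow> nat \<Rightarrow> 's cost_fun \<Rightarrow> (nat \<Rightarrow> 's play set) \<Rightarrow> 's play set
      \<Rightarrow> 's profile \<Rightarrow> bool" where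
  "is_solution G d c Obs Ob \<sigma> \<longleftrightarrow>
     is_profile G \<sigma> \<and>
     outcome G \<sigma> \<in> multi_energy G d c \<inter> Ob \<and>
     (\<forall>i\<in>players G. \<forall>\<tau>. is_strategy G i \<tau> \<longrightarrow>
        outcome G (\<sigma>(i := \<tau>)) \<in> Obs i \<inter> multi_energy G d c \<longrightarrow> outcome G \<sigma> \<in> Obs i)"


section \<open>Problem instances as finite data\<close>

text \<open>Objectives are presented either by a list of target states or by an LTL formula.\<close>

datatype objective = Reachability "nat list" | LTL "nat ltl"

fun objective_set :: "(nat, nat, 'm) arena_scheme \<Rightarrow> objective \<Rightarrow> nat play set" where
  "objective_set G (Reachability T) = reach G (set T)"
| "objective_set G (LTL \<phi>) = ltl_objective G \<phi>"

text \<open>The states are \<open>0, \<dots>, N - 1\<close>, where \<open>N\<close> is the length of \<open>inst_states\<close>, whose \<open>s\<close>-th entry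
  is the controlling player of \<open>s\<close> together with the propositions that hold in \<open>s\<close>. The
  propositions are the numbers below \<open>inst_props\<close>. The objective of player \<open>i\<close> is entry
  \<open>i - 1\<close> of \<open>inst_objs\<close>, as players are numbered from 1.\<close>

record game_instance =
  inst_players :: nat
  inst_states :: "(nat \<times> nat list) list"
  inst_init :: nat
  inst_props :: nat
  inst_dim :: nat
  inst_edges :: "((nat \<times> nat) \<times> int list) list"
  inst_objs :: "objective list"
  inst_spec :: objective

definition arena_of :: "game_instance \<Rightarrow> (nat, nat) arena" where
  "arena_of I =
     \<lparr> states = {..<length (inst_states I)},
       num_players = inst_players I,
       ctrl = (\<lambda>i. {s. s < length (inst_states I) \<and> fst (inst_states I ! s) = i}),
       init = inst_init I,
       edges = fst ` set (inst_edges I),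
       props = {..<inst_props I},
       label = (\<lambda>s. set (snd (inst_states I ! s))) \<rparr>"

definition cost_of :: "game_instance \<Rightarrow> nat cost_fun" where
  "cost_of I e k = the (map_of (inst_edges I) e) ! k"

fun wf_objective :: "(nat, nat, 'm) arena_scheme \<Rightarrow> objective \<Rightarrow> bool" where
  "wf_objective G (Reachability T) \<longleftrightarrow> set T \<subseteq> states G"
| "wf_objective G (LTL \<phi>) \<longleftrightarrow> set_ltl \<phi> \<subseteq> props G"

definition wf_instance :: "game_instance \<Rightarrow> bool" where
  "wf_instance I \<longleftrightarrow>
     wf_arena (arena_of I) \<and>
     distinct (map fst (inst_edges I)) \<and>
     (\<forall>(e, v)\<in>set (inst_edges I). length v = inst_dim I) \<and>
     length (inst_objs I) = inst_players I \<and>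
     (\<forall>ob\<in>set (inst_objs I). wf_objective (arena_of I) ob) \<and>
     wf_objective (arena_of I) (inst_spec I)"

definition has_solution :: "game_instance \<Rightarrow> bool" where
  "has_solution I \<longleftrightarrow>
     (\<exists>\<sigma>. is_solution (arena_of I) (inst_dim I) (cost_of I)
            (\<lambda>i. objective_set (arena_of I) (inst_objs I ! (i - 1)))
            (objective_set (arena_of I) (inst_spec I)) \<sigma>)"

definition is_reachability :: "objective \<Rightarrow> bool" where
  "is_reachability ob \<longleftrightarrow> (\<exists>T. ob = Reachability T)"

definition instances :: "game_instance set" where
  "instances = {I. wf_instance I}"

definition restricted_instances :: "game_instance set" where
  "restricted_instances =
     {I \<in> instances. inst_players I = 2 \<and> inst_dim I = 2 \<and>
        (\<forall>ob\<in>set (inst_objs I). is_reachability ob) \<and> is_reachability (inst_spec I)}"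

subsection \<open>Goedel numbering of instances\<close>

primrec encode_ltl :: "nat ltl \<Rightarrow> nat" where
  "encode_ltl TrueL = prod_encode (0, 0)"
| "encode_ltl (Atom p) = prod_encode (1, p)"
| "encode_ltl (Neg \<phi>) = prod_encode (2, encode_ltl \<phi>)"
| "encode_ltl (Conj \<phi> \<psi>) = prod_encode (3, prod_encode (encode_ltl \<phi>, encode_ltl \<psi>))"
| "encode_ltl (Next \<phi>) = prod_encode (4, encode_ltl \<phi>)"
| "encode_ltl (Until \<phi> \<psi>) = prod_encode (5, prod_encode (encode_ltl \<phi>, encode_ltl \<psi>))"

fun encode_objective :: "objective \<Rightarrow> nat" where
  "encode_objective (Reachability T) = prod_encode (0, list_encode T)"
| "encode_objective (LTL \<phi>) = prod_encode (1, encode_ltl \<phi>)"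

fun encode_state :: "nat \<times> nat list \<Rightarrow> nat" where
  "encode_state (i, ps) = prod_encode (i, list_encode ps)"

fun encode_edge :: "(nat \<times> nat) \<times> int list \<Rightarrow> nat" where
  "encode_edge (e, v) = prod_encode (prod_encode e, list_encode (map int_encode v))"

definition encode_instance :: "game_instance \<Rightarrow> nat" where
  "encode_instance I = list_encode
     [inst_players I,
      list_encode (map encode_state (inst_states I)),
      inst_init I,
      inst_props I,
      inst_dim I,
      list_encode (map encode_edge (inst_edges I)),
      list_encode (map encode_objective (inst_objs I)),
      encode_objective (inst_spec I)]"

lemma inj_encode_ltl: "inj encode_ltl"
proof (rule injI)
  fix \<phi> \<psi> :: "nat ltl" assume "encode_ltl \<phi> = encode_ltl \<psi>"
  then show "\<phi> = \<psi>"
  proof (induction \<phi> arbitrary: \<psi>)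
    case TrueL then show ?case by (cases \<psi>) auto
  next
    case (Atom p) then show ?case by (cases \<psi>) auto
  next
    case (Neg \<phi>) then show ?case by (cases \<psi>) auto
  next
    case (Conj \<phi>1 \<phi>2) then show ?case by (cases \<psi>) auto
  next
    case (Next \<phi>) then show ?case by (cases \<psi>) auto
  next
    case (Until \<phi>1 \<phi>2) then show ?case by (cases \<psi>) auto
  qed
qed

lemma inj_encode_instance: "inj encode_instance"
proof -
  have "inj encode_objective"
  proof (rule injI)
    fix a b assume "encode_objective a = encode_objective b"
    then show "a = b" by (cases a; cases b) (auto simp: list_encode_eq dest: injD[OF inj_encode_ltl])
  qed
  moreover have "inj encode_state"
  proof (rule injI)
    fix a b assume "encode_state a = encode_state b"
    then show "a = b" by (cases a; cases b) (simp add: list_encode_eq)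
  qed
  moreover have "inj encode_edge"
  proof (rule injI)
    fix a b assume "encode_edge a = encode_edge b"
    then show "a = b"
      by (cases a; cases b) (simp add: list_encode_eq inj_map_eq_map[OF inj_int_encode])
  qed
  ultimately show ?thesis
    by (intro injI game_instance.equality)
      (simp_all add: encode_instance_def list_encode_eq inj_map_eq_map inj_eq)
qed


section \<open>Decidability by partial recursive functions\<close>

text \<open>\<open>Mu f\<close> searches in the first argument of \<open>f\<close>; \<open>PrimRec f g\<close> recurses on the first
  argument, \<open>g\<close> receiving the predecessor, the recursive value and the parameters.\<close>

datatype recf =
    Zero
  | Succ
  | Proj nat
  | Comp recf "recf list"
  | PrimRec recf recf
  | Mu recf

inductive rec_eval :: "recf \<Rightarrow> nat list \<Rightarrow> nat \<Rightarrow> bool" where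
  zero: "rec_eval Zero xs 0"
| succ: "rec_eval Succ [x] (Suc x)"
| proj: "i < length xs \<Longrightarrow> rec_eval (Proj i) xs (xs ! i)"
| comp: "length ys = length gs \<Longrightarrow> (\<forall>i<length gs. rec_eval (gs ! i) xs (ys ! i)) \<Longrightarrow>
    rec_eval f ys z \<Longrightarrow> rec_eval (Comp f gs) xs z"
| prim_0: "rec_eval f xs y \<Longrightarrow> rec_eval (PrimRec f g) (0 # xs) y"
| prim_Suc: "rec_eval (PrimRec f g) (n # xs) r \<Longrightarrow> rec_eval g (n # r # xs) y \<Longrightarrow>
    rec_eval (PrimRec f g) (Suc n # xs) y"
| mu: "rec_eval f (n # xs) 0 \<Longrightarrow> (\<forall>m<n. \<exists>y>0. rec_eval f (m # xs) y) \<Longrightarrow>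
    rec_eval (Mu f) xs n"

inductive_cases zeroE: "rec_eval Zero xs z"
inductive_cases succE: "rec_eval Succ xs z"
inductive_cases projE: "rec_eval (Proj i) xs z"
inductive_cases compE: "rec_eval (Comp f gs) xs z"
inductive_cases prim_0E: "rec_eval (PrimRec f g) (0 # xs) z"
inductive_cases prim_SucE: "rec_eval (PrimRec f g) (Suc n # xs) z"
inductive_cases muE: "rec_eval (Mu f) xs z"

lemma rec_eval_deterministic: "rec_eval f xs y \<Longrightarrow> rec_eval f xs z \<Longrightarrow> y = z"
proof (induction arbitrary: z rule: rec_eval.induct)
  case (zero xs)
  then show ?case by (blast elim: zeroE)
next
  case (succ x)
  then show ?case by (auto elim: succE)
next
  case (proj i xs)
  then show ?case by (auto elim: projE)
next
  case (comp ys gs xs f v)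
  obtain ys' where ys': "length ys' = length gs"
    "\<forall>i<length gs. rec_eval (gs ! i) xs (ys' ! i)" "rec_eval f ys' z"
    using comp.prems by (rule compE)
  then have "ys = ys'" using comp by (intro nth_equalityI) auto
  then show ?case using comp.IH ys' by blast
next
  case (prim_0 f xs y g)
  then show ?case by (blast elim: prim_0E)
next
  case (prim_Suc f g n xs r y)
  obtain r' where "rec_eval (PrimRec f g) (n # xs) r'" "rec_eval g (n # r' # xs) z"
    using prim_Suc.prems by (rule prim_SucE)
  then show ?case using prim_Suc.IH by blast
next
  case (mu f n xs)
  have z: "rec_eval f (z # xs) 0" "\<forall>m<z. \<exists>y>0. rec_eval f (m # xs) y"
    using mu.prems by (auto elim: muE)
  show ?case
  proof (rule linorder_cases[of n z])
    assume "n < z"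
    then obtain y where "y > 0" "rec_eval f (n # xs) y" using z(2) by blast
    then show ?thesis using mu.IH(1) by blast
  next
    assume "z < n"
    then obtain y where "y > 0" "\<forall>w. rec_eval f (z # xs) w \<longrightarrow> y = w" using mu.IH(2) by blast
    then show ?thesis using z(1) by blast
  qed
qed

text \<open>The problem of deciding \<open>P\<close> on the inputs in \<open>D\<close>, given by their codes. A decision
  procedure may diverge or answer arbitrarily on numbers that are not codes of elements of \<open>D\<close>.\<close>

definition decidable_on :: "('a \<Rightarrow> nat) \<Rightarrow> 'a set \<Rightarrow> ('a \<Rightarrow> bool) \<Rightarrow> bool" where
  "decidable_on enc D P \<longleftrightarrow>
     (\<exists>f. \<forall>x\<in>D. rec_eval f [enc x] (if P x then 1 else 0))"

end

theory Submission
  imports Defs "HOL-Computational_Algebra.Primes" "HOL-Library.Infinite_Set"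
begin

text \<open>A game with two resources can simulate a nondeterministic two-counter automaton: player 1
  chooses the run, the resources are the counters, and the energy condition forbids negative
  values. Tests that a counter is less than some bound \<open>p\<close> are enforced by player 2. At a test she
  may divert the play to her target by paying \<open>p\<close> units of the counter; this deviation respects
  the energy condition, and hence ruins the solution, exactly if the test should have failed.

  Every recursive function is computed by such an automaton, the registers being kept as
  exponents in a product of prime powers. Given a decision procedure \<open>f\<close>, take the automaton that
  on input \<open>(a, b)\<close> accepts if \<open>f\<close> rejects the game whose list of states has code \<open>a\<close>, whose list of
  edges (except for the first edge, which loads the input into the counter) has code \<open>b\<close>, and whose
  input is \<open>(a, b)\<close>. On the game of this very automaton \<open>f\<close> errs. No universal function is needed.\<close>

section \<open>Register programs for recursive functions\<close>

text \<open>The obstacle to self-application is that an instance would have to contain its own code.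
  It is overcome by letting the input enter the game through the cost of a single edge: the states
  and the other edges depend on the program alone, and the program is fixed before the codes
  \<open>a\<close> and \<open>b\<close> are formed. The number loaded by that edge,
  \<open>2 ^ a * 3 ^ b\<close>, is already the Goedel number of a store holding \<open>a\<close> and
  \<open>b\<close> in its first two registers, so the automaton starts on its input directly. The
  code of the whole game is obtained from \<open>a\<close> and \<open>b\<close> by arithmetic,
  without decoding either of them. Test bounds \<open>p > 1\<close> come from division with
  remainder: a remainder is recognised by being less than the divisor. The decision procedure may
  diverge on numbers that code no instance, so partial functions have to be simulated faithfully;
  this is done by exact equations between sets of results.\<close>

datatype 'a prog = Act 'a | Seq "'a prog" "'a prog" | Star "'a prog"

text \<open>The final states form a set: a failed test or a diverging computation yields no state.
  \<open>Star\<close> may stop after any number of rounds, and a test placed behind it discards the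
  wrong guesses.\<close>

primrec run :: "('a \<Rightarrow> 's \<Rightarrow> 's set) \<Rightarrow> 'a prog \<Rightarrow> 's \<Rightarrow> 's set" where
  "run A (Act a) v = A a v"
| "run A (Seq P Q) v = (\<Union>w\<in>run A P v. run A Q w)"
| "run A (Star P) v = {w. (\<lambda>x y. y \<in> run A P x)\<^sup>*\<^sup>* v w}"

lemma run_Star_unfold: "run A (Star P) v = insert v (\<Union>w\<in>run A P v. run A (Star P) w)"
  by (auto intro: converse_rtranclp_into_rtranclp elim: converse_rtranclpE)

declare run.simps(3) [simp del]

text \<open>The loop invariant rule, with \<open>X\<close> as the invariant.\<close>

lemma run_Star_least:
  assumes "v \<in> X" "\<And>w. w \<in> X \<Longrightarrow> run A P w \<subseteq> X"
  shows "run A (Star P) v \<subseteq> X"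
proof
  fix w assume "w \<in> run A (Star P) v"
  then have "(\<lambda>x y. y \<in> run A P x)\<^sup>*\<^sup>* v w" by (simp add: run.simps)
  then show "w \<in> X" by induction (use assms in auto)
qed

lemma run_Star_refl: "v \<in> run A (Star P) v"
  by (simp add: run.simps)

lemma run_Star_snoc: "w \<in> run A (Star P) v \<Longrightarrow> u \<in> run A P w \<Longrightarrow> u \<in> run A (Star P) v"
  by (auto simp: run.simps intro: rtranclp.rtrancl_into_rtrancl)

section \<open>Register programs and their basic building blocks\<close>

datatype reg_act = Inc nat | Dec nat | Tst nat

type_synonym store = "nat \<Rightarrow> nat"

primrec reg_sem :: "reg_act \<Rightarrow> store \<Rightarrow> store set" where
  "reg_sem (Inc i) v = {v(i := Suc (v i))}"
| "reg_sem (Dec i) v = (if v i = 0 then {} else {v(i := v i - 1)})"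
| "reg_sem (Tst i) v = (if v i = 0 then {v} else {})"

abbreviation rrun :: "reg_act prog \<Rightarrow> store \<Rightarrow> store set" where
  "rrun \<equiv> run reg_sem"

definition skip :: "reg_act prog" where
  "skip = Seq (Act (Inc 0)) (Act (Dec 0))"

lemma rrun_skip: "rrun skip v = {v}"
  by (auto simp: skip_def)

definition fail :: "reg_act prog" where
  "fail = Seq (Act (Inc 0)) (Act (Tst 0))"

lemma rrun_fail: "rrun fail v = {}"
  by (auto simp: fail_def)

definition countdown :: "nat \<Rightarrow> reg_act prog \<Rightarrow> reg_act prog" where
  "countdown i B = Seq (Star (Seq (Act (Dec i)) B)) (Act (Tst i))"

text \<open>If the register is zero, \<open>Dec i\<close> blocks another round; if it is positive,
  the exit test blocks leaving. So at every moment only one of the two continuations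
  survives.\<close>

lemma rrun_countdown:
  "rrun (countdown i B) v =
    (if v i = 0 then {v} else (\<Union>w\<in>rrun B (v(i := v i - 1)). rrun (countdown i B) w))"
  unfolding countdown_def run.simps(2)
  by (subst run_Star_unfold) (auto split: if_splits)

definition move :: "nat \<Rightarrow> nat \<Rightarrow> reg_act prog" where
  "move i k = countdown i (Act (Inc k))"

lemma rrun_move: "i \<noteq> k \<Longrightarrow> rrun (move i k) v = {v(i := 0, k := v k + v i)}"
proof (induction "v i" arbitrary: v)
  case 0
  then show ?case by (simp add: move_def rrun_countdown fun_upd_idem)
next
  case (Suc n)
  define w where "w = v(i := n, k := Suc (v k))"
  have "rrun (move i k) v = rrun (move i k) w"
    using Suc.prems unfolding move_def
    by (subst rrun_countdown) (simp add: Suc.hyps(2)[symmetric] w_def)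
  also have "\<dots> = {w(i := 0, k := w k + w i)}"
    using Suc.hyps(1)[of w] Suc.prems by (simp add: w_def)
  finally show ?case using Suc.prems Suc.hyps(2) by (auto simp: w_def fun_upd_def)
qed

definition clear :: "nat \<Rightarrow> reg_act prog" where
  "clear i = Seq (Star (Act (Dec i))) (Act (Tst i))"

lemma rrun_clear: "rrun (clear i) v = {v(i := 0)}"
proof (induction "v i" arbitrary: v)
  case 0
  then show ?case unfolding clear_def run.simps(2)
    by (subst run_Star_unfold) (auto simp: fun_upd_idem)
next
  case (Suc n)
  have "rrun (clear i) v = rrun (clear i) (v(i := n))"
    unfolding clear_def run.simps(2)
    by (subst run_Star_unfold) (simp add: Suc.hyps(2)[symmetric])
  then show ?case using Suc.hyps(1)[of "v(i := n)"] by simp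
qed

text \<open>A register can only be read by counting it down. Its content is therefore split into the
  target and a scratch register \<open>t\<close>, from which it is restored.\<close>

definition copy :: "nat \<Rightarrow> nat \<Rightarrow> nat \<Rightarrow> reg_act prog" where
  "copy i k t = Seq (countdown i (Seq (Act (Inc k)) (Act (Inc t)))) (move t i)"

lemma rrun_copy:
  assumes "i \<noteq> k" "t \<noteq> i" "t \<noteq> k" "v t = 0"
  shows "rrun (copy i k t) v = {v(k := v k + v i)}"
proof -
  have *: "rrun (countdown i (Seq (Act (Inc k)) (Act (Inc t)))) v =
      {v(i := 0, k := v k + v i, t := v t + v i)}" for v
  proof (induction "v i" arbitrary: v)
    case 0
    then show ?case by (subst rrun_countdown) (simp add: fun_upd_idem)
  next
    case (Suc n)
    define w where "w = v(i := n, k := Suc (v k), t := Suc (v t))"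
    have "rrun (countdown i (Seq (Act (Inc k)) (Act (Inc t)))) v =
        rrun (countdown i (Seq (Act (Inc k)) (Act (Inc t)))) w"
      using assms by (subst rrun_countdown) (simp add: Suc.hyps(2)[symmetric] w_def)
    also have "\<dots> = {w(i := 0, k := w k + w i, t := w t + w i)}"
      using Suc.hyps(1)[of w] assms by (simp add: w_def)
    finally show ?case using assms Suc.hyps(2) by (auto simp: w_def fun_upd_def)
  qed
  show ?thesis unfolding copy_def using assms
    by (auto simp: * rrun_move fun_upd_def)
qed

section \<open>Compilation of recursive functions into register programs\<close>

text \<open>Adding the result to the output register, rather than storing it, makes
  the effect independent of the old content of that register.\<close>

definition realizes :: "reg_act prog \<Rightarrow> nat list \<Rightarrow> nat \<Rightarrow> nat \<Rightarrow> recf \<Rightarrow> bool" where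
  "realizes P ins k b g \<longleftrightarrow> (\<forall>v. (\<forall>j\<ge>b. v j = 0) \<longrightarrow>
     rrun P v = {v(k := v k + y) | y. rec_eval g (map v ins) y})"

lemma realizesD:
  "realizes P ins k b g \<Longrightarrow> (\<And>j. j \<ge> b \<Longrightarrow> v j = 0) \<Longrightarrow>
    rrun P v = {v(k := v k + y) | y. rec_eval g (map v ins) y}"
  by (simp add: realizes_def)

primrec add_from :: "nat \<Rightarrow> nat list \<Rightarrow> store \<Rightarrow> store" where
  "add_from b [] v = v"
| "add_from b (y # ys) v = add_from (Suc b) ys (v(b := v b + y))"

lemma add_from_eq:
  "add_from b ys v j = (if b \<le> j \<and> j < b + length ys then v j + ys ! (j - b) else v j)"
  by (induction ys arbitrary: b v) (auto simp: nth_Cons' Suc_diff_Suc)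

text \<open>Evaluates the arguments of a composition into consecutive registers from
  \<open>b\<close> on. The bound \<open>c\<close> of the scratch area stays fixed while
  \<open>b\<close> moves up, so each evaluation finds clean scratch space although earlier results
  are already stored below \<open>c\<close>.\<close>

lemma realizes_list:
  assumes "\<And>g ins k b. g \<in> set gs \<Longrightarrow> set ins \<subseteq> {..<b} \<Longrightarrow> k < b \<Longrightarrow> k \<notin> set ins \<Longrightarrow>
      \<exists>P. realizes P ins k b g"
    and "set ins \<subseteq> {..<b}" "b + length gs \<le> c"
  shows "\<exists>P. \<forall>v. (\<forall>j\<ge>c. v j = 0) \<longrightarrow>
      rrun P v = {add_from b ys v | ys. list_all2 (\<lambda>g. rec_eval g (map v ins)) gs ys}"
  using assms
proof (induction gs arbitrary: b)
  case Nil
  show ?case by (rule exI[of _ skip]) (auto simp: rrun_skip)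
next
  case (Cons g gs)
  obtain P where P: "realizes P ins b c g"
    using Cons.prems(1)[of g ins c b] Cons.prems(2,3) by (fastforce simp: subset_iff)
  have "\<exists>Q. \<forall>v. (\<forall>j\<ge>c. v j = 0) \<longrightarrow>
      rrun Q v = {add_from (Suc b) ys v | ys. list_all2 (\<lambda>g. rec_eval g (map v ins)) gs ys}"
  proof (rule Cons.IH)
    show "\<exists>P. realizes P ins k b h" if "h \<in> set gs" "set ins \<subseteq> {..<b}" "k < b" "k \<notin> set ins"
      for h ins k b using Cons.prems(1)[of h ins b k] that by simp
  qed (use Cons.prems(2,3) in auto)
  then obtain Q where Q: "\<forall>v. (\<forall>j\<ge>c. v j = 0) \<longrightarrow>
      rrun Q v = {add_from (Suc b) ys v | ys. list_all2 (\<lambda>g. rec_eval g (map v ins)) gs ys}"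
    by blast
  show ?case
  proof (intro exI[of _ "Seq P Q"] allI impI)
    fix v :: store assume v: "\<forall>j\<ge>c. v j = 0"
    have m: "map (v(b := z)) ins = map v ins" for z using Cons.prems(2) by auto
    have "rrun Q (v(b := v b + y)) = {add_from (Suc b) ys (v(b := v b + y)) | ys.
        list_all2 (\<lambda>g. rec_eval g (map v ins)) gs ys}" for y
      using Q[rule_format, of "v(b := v b + y)"] v Cons.prems(3) unfolding m by simp
    moreover have "rrun P v = {v(b := v b + y) | y. rec_eval g (map v ins) y}"
      using realizesD[OF P, of v] v by simp
    ultimately have "rrun (Seq P Q) v = (\<Union>y\<in>{y. rec_eval g (map v ins) y}.
        {add_from (Suc b) ys (v(b := v b + y)) | ys. list_all2 (\<lambda>g. rec_eval g (map v ins)) gs ys})"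
      by auto
    also have "\<dots> = {add_from b (y # ys) v | y ys.
        rec_eval g (map v ins) y \<and> list_all2 (\<lambda>g. rec_eval g (map v ins)) gs ys}"
      unfolding add_from.simps by blast
    also have "\<dots> = {add_from b ys v | ys. list_all2 (\<lambda>g. rec_eval g (map v ins)) (g # gs) ys}"
      unfolding list_all2_Cons1 by blast
    finally show "rrun (Seq P Q) v = \<dots>" .
  qed
qed

lemma rrun_clear_range: "\<exists>P. \<forall>v. rrun P v = {\<lambda>j. if b \<le> j \<and> j < b + n then 0 else v j}"
proof (induction n)
  case 0
  show ?case by (rule exI[of _ skip]) (auto simp: rrun_skip)
next
  case (Suc n)
  then obtain P where P: "\<forall>v. rrun P v = {\<lambda>j. if b \<le> j \<and> j < b + n then 0 else v j}" by blast
  show ?case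
    by (rule exI[of _ "Seq P (clear (b + n))"]) (auto simp: P rrun_clear fun_upd_def less_Suc_eq)
qed


text \<open>The arguments go to the \<open>n\<close> registers from \<open>b\<close> on,
  \<open>f\<close> reads them there with its scratch area above, and the final clearing removes
  them, so that only register \<open>k\<close> has changed.\<close>

lemma realizes_Comp:
  assumes "\<And>g ins k b. g \<in> insert f (set gs) \<Longrightarrow> set ins \<subseteq> {..<b} \<Longrightarrow> k < b \<Longrightarrow> k \<notin> set ins \<Longrightarrow>
      \<exists>P. realizes P ins k b g"
    and "set ins \<subseteq> {..<b}" "k < b" "k \<notin> set ins"
  shows "\<exists>P. realizes P ins k b (Comp f gs)"
proof -
  define n where "n = length gs"
  obtain P where P: "\<forall>v. (\<forall>j\<ge>b + n. v j = 0) \<longrightarrow>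
      rrun P v = {add_from b ys v | ys. list_all2 (\<lambda>g. rec_eval g (map v ins)) gs ys}"
    using realizes_list[of gs ins b "b + n"] assms(1,2) unfolding n_def by blast
  obtain Q where Q: "realizes Q [b..<b + n] k (b + n) f"
    using assms(1)[of f "[b..<b + n]" "b + n" k] assms(2,3) by (fastforce simp: subset_iff)
  obtain R where R: "\<forall>v. rrun R v = {\<lambda>j. if b \<le> j \<and> j < b + n then 0 else v j}"
    using rrun_clear_range by blast
  have "rrun (Seq P (Seq Q R)) v = {v(k := v k + y) | y. rec_eval (Comp f gs) (map v ins) y}"
    if v: "\<forall>j\<ge>b. v j = 0" for v
  proof -
    have *: "rrun (Seq Q R) (add_from b ys v) = {v(k := v k + y) | y. rec_eval f ys y}"
      if len: "length ys = n" for ys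
    proof -
      have "map (add_from b ys v) [b..<b + n] = ys"
        using len v by (intro nth_equalityI) (auto simp: add_from_eq)
      moreover have "add_from b ys v j = 0" if "j \<ge> b + n" for j
        using len v that by (simp add: add_from_eq)
      ultimately have Q': "rrun Q (add_from b ys v) =
          {(add_from b ys v)(k := v k + y) | y. rec_eval f ys y}"
        using realizesD[OF Q, of "add_from b ys v"] assms(3) by (simp add: add_from_eq)
      have "(\<lambda>j. if b \<le> j \<and> j < b + n then 0 else ((add_from b ys v)(k := z)) j) = v(k := z)" for z
        using v assms(3) len by (auto simp: add_from_eq)
      then show ?thesis by (auto simp: Q' R)
    qed
    have "rec_eval (Comp f gs) (map v ins) y \<longleftrightarrow>
        (\<exists>ys. list_all2 (\<lambda>g. rec_eval g (map v ins)) gs ys \<and> rec_eval f ys y)" for y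
      by (auto simp: list_all2_conv_all_nth intro: rec_eval.comp elim!: compE) metis
    moreover have "rrun (Seq P (Seq Q R)) v =
      (\<Union>ys\<in>{ys. list_all2 (\<lambda>g. rec_eval g (map v ins)) gs ys}. rrun (Seq Q R) (add_from b ys v))"
      using P v by (auto simp del: run.simps(2) simp: run.simps(2)[of _ P])
    ultimately show ?thesis
      using * by (fastforce simp: n_def list_all2_lengthD simp del: run.simps)
  qed
  then show ?thesis unfolding realizes_def by blast
qed

text \<open>The program computes all intermediate values of a recursion; that they exist has to be
  inferred from the existence of the last one.\<close>

lemma rec_eval_PrimRec_downward:
  "rec_eval (PrimRec f g) ((m + n) # xs) y \<Longrightarrow> \<exists>z. rec_eval (PrimRec f g) (m # xs) z"
  by (induction n arbitrary: y) (auto elim: prim_SucE)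

lemma realizes_PrimRec:
  assumes IHf: "\<And>ins k b. set ins \<subseteq> {..<b} \<Longrightarrow> k < b \<Longrightarrow> k \<notin> set ins \<Longrightarrow> \<exists>P. realizes P ins k b f"
    and IHg: "\<And>ins k b. set ins \<subseteq> {..<b} \<Longrightarrow> k < b \<Longrightarrow> k \<notin> set ins \<Longrightarrow> \<exists>P. realizes P ins k b g"
    and ins: "set (i # ins) \<subseteq> {..<b}" "k < b" "k \<notin> set (i # ins)"
  shows "\<exists>P. realizes P (i # ins) k b (PrimRec f g)"
proof -
  \<comment> \<open>Register \<open>b\<close> counts the finished rounds, \<open>r\<close> holds the
    current value, \<open>c\<close> the number of rounds left, and \<open>s\<close> receives the
    next value from \<open>g\<close>.\<close>
  define r c s where "r = Suc b" and "c = Suc r" and "s = Suc c"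
  note regs = r_def c_def s_def
  obtain F where F: "realizes F ins r s f"
    using IHf[of ins s r] ins regs by (fastforce simp: subset_iff)
  obtain G where G: "realizes G (b # r # ins) s (Suc s) g"
    using IHg[of "b # r # ins" "Suc s" s] ins regs by (fastforce simp: subset_iff)
  define B where "B = Seq G (Seq (clear r) (Seq (move s r) (Act (Inc b))))"
  define P where "P = Seq F (Seq (copy i c s) (Seq (countdown c B) (Seq (move r k) (clear b))))"
  have "rrun P v = {v(k := v k + y) | y. rec_eval (PrimRec f g) (map v (i # ins)) y}"
    if v: "\<forall>j\<ge>b. v j = 0" for v
  proof -
    define xs where "xs = map v ins"
    define st where "st x y m = v(b := x, r := y, c := m)" for x y m :: nat
    have B: "rrun B (st x y m) = {st (Suc x) z m | z. rec_eval g (x # y # xs) z}" for x y m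
    proof -
      have "map (st x y m) ins = xs"
        using ins by (auto simp: st_def xs_def regs)
      then have "map (st x y m) (b # r # ins) = x # y # xs"
        by (simp add: st_def regs)
      moreover have "st x y m j = 0" if "j \<ge> s" for j using v that by (simp add: st_def regs)
      ultimately have "rrun G (st x y m) = {(st x y m)(s := z) | z. rec_eval g (x # y # xs) z}"
        using realizesD[OF G, of "st x y m"] by simp
      moreover have "rrun (Seq (clear r) (Seq (move s r) (Act (Inc b)))) ((st x y m)(s := z)) =
          {st (Suc x) z m}" for z
        using v by (auto simp: rrun_clear rrun_move regs st_def fun_upd_def)
      ultimately show ?thesis by (auto simp: B_def simp del: run.simps(2) simp: run.simps(2)[of _ G])
    qed
    have loop: "rrun (countdown c B) (st x y m) =
        {st (x + m) z 0 | z. rec_eval (PrimRec f g) ((x + m) # xs) z}"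
      if "rec_eval (PrimRec f g) (x # xs) y" for x y m
      using that
    proof (induction m arbitrary: x y)
      case 0
      then show ?case
        by (subst rrun_countdown) (auto simp: st_def dest: rec_eval_deterministic)
    next
      case (Suc m)
      have "rrun (countdown c B) (st x y (Suc m)) = (\<Union>w\<in>rrun B (st x y m). rrun (countdown c B) w)"
        by (subst rrun_countdown) (simp add: st_def)
      also have "\<dots> = (\<Union>z\<in>{z. rec_eval g (x # y # xs) z}. rrun (countdown c B) (st (Suc x) z m))"
        by (auto simp: B)
      also have "\<dots> = (\<Union>z\<in>{z. rec_eval g (x # y # xs) z}.
          {st (Suc x + m) z 0 | z. rec_eval (PrimRec f g) ((Suc x + m) # xs) z})"
        using Suc.IH prim_Suc[OF Suc.prems] by (intro SUP_cong) auto
      also have "\<dots> = {st (Suc x + m) z 0 | z. rec_eval (PrimRec f g) ((Suc x + m) # xs) z}"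
      proof -
        \<comment> \<open>The union on the left is empty if \<open>g\<close> has no value in this
          round. The right side is then empty too, since a later value presupposes this one.\<close>
        have "\<exists>z. rec_eval g (x # y # xs) z" if "rec_eval (PrimRec f g) ((Suc x + m) # xs) z" for z
          using rec_eval_PrimRec_downward[OF that] rec_eval_deterministic[OF Suc.prems]
          by (auto elim!: prim_SucE)
        then show ?thesis by blast
      qed
      finally show ?case by simp
    qed
    have F': "rrun F v = {v(r := y) | y. rec_eval f xs y}"
      using realizesD[OF F, of v] v by (simp add: xs_def regs)
    have copy': "rrun (copy i c s) (v(r := y)) = {st 0 y (v i)}" for y
    proof -
      have "i < b" using ins(1) by simp
      then show ?thesis using v by (subst rrun_copy) (auto simp: st_def regs)
    qed
    have fin: "rrun (Seq (move r k) (clear b)) (st x y 0) = {v(k := v k + y)}" for x y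
      using v ins(2) by (auto simp: rrun_move rrun_clear st_def fun_upd_def regs)
    have "rrun P v = (\<Union>u\<in>rrun F v. \<Union>u'\<in>rrun (copy i c s) u. \<Union>w\<in>rrun (countdown c B) u'.
        rrun (Seq (move r k) (clear b)) w)"
      by (simp only: P_def run.simps(2))
    also have "\<dots> = (\<Union>y\<in>{y. rec_eval f xs y}. \<Union>u'\<in>rrun (copy i c s) (v(r := y)).
        \<Union>w\<in>rrun (countdown c B) u'. rrun (Seq (move r k) (clear b)) w)"
      unfolding F' by blast
    also have "\<dots> = (\<Union>y\<in>{y. rec_eval f xs y}. \<Union>w\<in>rrun (countdown c B) (st 0 y (v i)).
        rrun (Seq (move r k) (clear b)) w)"
      by (simp only: copy' UN_insert UN_empty Un_empty_right)
    also have "\<dots> = (\<Union>y\<in>{y. rec_eval f xs y}.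
        {v(k := v k + z) | z. rec_eval (PrimRec f g) (v i # xs) z})"
      using fin by (intro SUP_cong) (auto simp: loop[OF prim_0] simp del: run.simps(2))
    also have "\<dots> = {v(k := v k + z) | z. rec_eval (PrimRec f g) (v i # xs) z}"
    proof -
      have "\<exists>y. rec_eval f xs y" if "rec_eval (PrimRec f g) (v i # xs) z" for z
        using rec_eval_PrimRec_downward[of f g 0 "v i" xs z] that by (auto elim: prim_0E)
      then show ?thesis by blast
    qed
    finally show ?thesis by (simp add: xs_def)
  qed
  then show ?thesis unfolding realizes_def by blast
qed

lemma realizes_Mu:
  assumes IH: "\<And>ins k b. set ins \<subseteq> {..<b} \<Longrightarrow> k < b \<Longrightarrow> k \<notin> set ins \<Longrightarrow> \<exists>P. realizes P ins k b f"
    and ins: "set ins \<subseteq> {..<b}" "k < b" "k \<notin> set ins"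
  shows "\<exists>P. realizes P ins k b (Mu f)"
proof -
  define r where "r = Suc b"
  obtain F where F: "realizes F (b # ins) r (Suc r) f"
    using IH[of "b # ins" "Suc r" r] ins r_def by (fastforce simp: subset_iff)
  \<comment> \<open>Register \<open>b\<close> holds the candidate and \<open>r\<close> the value of
    \<open>f\<close> on it. \<open>Dec r\<close> blocks on the value zero, so a round skips only
    candidates with a positive value; the test after the loop keeps only exits at a candidate with
    value zero.\<close>
  define B where "B = Seq F (Seq (Seq (Act (Dec r)) (clear r)) (Act (Inc b)))"
  define P where "P = Seq (Star B) (Seq F (Seq (Act (Tst r)) (move b k)))"
  have "rrun P v = {v(k := v k + y) | y. rec_eval (Mu f) (map v ins) y}"
    if v: "\<forall>j\<ge>b. v j = 0" for v
  proof -
    define xs where "xs = map v ins"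
    have F': "rrun F (v(b := n)) = {v(b := n, r := y) | y. rec_eval f (n # xs) y}" for n
    proof -
      have "map (v(b := n)) (b # ins) = n # xs" using ins(1) by (auto simp: xs_def)
      then show ?thesis using realizesD[OF F, of "v(b := n)"] v by (simp add: r_def)
    qed
    have "rrun (Seq (Seq (Act (Dec r)) (clear r)) (Act (Inc b))) (v(b := n, r := y)) =
        (if y = 0 then {} else {v(b := Suc n)})" for n y
      using v by (auto simp: rrun_clear r_def fun_upd_def)
    then have B: "rrun B (v(b := n)) = {v(b := Suc n) | y. y > 0 \<and> rec_eval f (n # xs) y}" for n
      by (auto simp: B_def F' simp del: run.simps(2) simp: run.simps(2)[of _ F] split: if_splits)
    \<comment> \<open>The loop invariant: all candidates below the current one have been tried and
      gave positive values.\<close>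
    define X where "X = (\<lambda>n. v(b := n)) ` {n. \<forall>m<n. \<exists>y>0. rec_eval f (m # xs) y}"
    have "rrun (Star B) v \<subseteq> X"
    proof (rule run_Star_least)
      have "v = v(b := 0)" using v by (simp add: fun_upd_idem)
      then show "v \<in> X" unfolding X_def by blast
      show "rrun B w \<subseteq> X" if "w \<in> X" for w
        using that by (auto simp: X_def B less_Suc_eq simp del: run.simps)
    qed
    moreover have "v(b := n) \<in> rrun (Star B) v" if "\<forall>m<n. \<exists>y>0. rec_eval f (m # xs) y" for n
      using that
    proof (induction n)
      case 0
      show ?case using v run_Star_refl[of v] by (simp add: fun_upd_idem)
    next
      case (Suc n)
      have "v(b := n) \<in> rrun (Star B) v" using Suc.IH Suc.prems less_SucI by blast
      moreover have "v(b := Suc n) \<in> rrun B (v(b := n))" using Suc.prems B by blast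
      ultimately show ?case by (rule run_Star_snoc)
    qed
    ultimately have "rrun (Star B) v = X" by (auto simp: X_def)
    then have "rrun P v = (\<Union>w\<in>X. rrun (Seq F (Seq (Act (Tst r)) (move b k))) w)"
      by (simp only: P_def run.simps(2)[of _ "Star B"])
    then have "rrun P v = (\<Union>n\<in>{n. \<forall>m<n. \<exists>y>0. rec_eval f (m # xs) y}.
        rrun (Seq F (Seq (Act (Tst r)) (move b k))) (v(b := n)))"
      by (simp add: X_def del: run.simps)
    moreover have "rrun (Seq (Act (Tst r)) (move b k)) (v(b := n, r := y)) =
        (if y = 0 then {v(k := v k + n)} else {})" for n y
      using v ins(2) by (auto simp: rrun_move r_def fun_upd_def)
    then have "rrun (Seq F (Seq (Act (Tst r)) (move b k))) (v(b := n)) =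
        (if rec_eval f (n # xs) 0 then {v(k := v k + n)} else {})" for n
      by (auto simp: run.simps(2)[of _ F] F' simp del: run.simps(2) split: if_splits)
    ultimately have "rrun P v = {v(k := v k + n) | n.
        rec_eval f (n # xs) 0 \<and> (\<forall>m<n. \<exists>y>0. rec_eval f (m # xs) y)}"
      by (auto simp del: run.simps split: if_splits)
    then show ?thesis by (auto simp: xs_def intro: rec_eval.mu elim!: muE)
  qed
  then show ?thesis unfolding realizes_def by blast
qed

text \<open>Applications with a wrong number of arguments have no value and are matched by
  \<open>fail\<close>, a program without completed runs.\<close>

lemma rec_eval_realizable:
  "set ins \<subseteq> {..<b} \<Longrightarrow> k < b \<Longrightarrow> k \<notin> set ins \<Longrightarrow> \<exists>P. realizes P ins k b g"
proof (induction g arbitrary: ins k b)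
  case Zero
  have "rec_eval Zero xs y \<longleftrightarrow> y = 0" for xs y by (auto intro: rec_eval.zero elim: zeroE)
  then have "realizes skip ins k b Zero" by (auto simp: realizes_def rrun_skip)
  then show ?case ..
next
  case Succ
  show ?case
  proof (cases "\<exists>i. ins = [i]")
    case True
    then obtain i where i: "ins = [i]" by blast
    have "rec_eval Succ [x] y \<longleftrightarrow> y = Suc x" for x y by (auto intro: rec_eval.succ elim: succE)
    then have "realizes (Seq (copy i k b) (Act (Inc k))) ins k b Succ"
      using Succ i by (auto simp: realizes_def rrun_copy)
    then show ?thesis ..
  next
    case False
    then have "\<not> rec_eval Succ (map v ins) y" for v y by (auto elim!: succE)
    then have "realizes fail ins k b Succ" by (auto simp: realizes_def rrun_fail)
    then show ?thesis ..
  qed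
next
  case (Proj i)
  have *: "rec_eval (Proj i) xs y \<longleftrightarrow> i < length xs \<and> y = xs ! i" for xs y
    by (auto intro: rec_eval.proj elim: projE)
  show ?case
  proof (cases "i < length ins")
    case True
    then have "ins ! i \<in> set ins" by simp
    then have "ins ! i < b" "ins ! i \<noteq> k" using Proj by auto
    then have "realizes (copy (ins ! i) k b) ins k b (Proj i)"
      using True Proj by (auto simp: realizes_def rrun_copy *)
    then show ?thesis ..
  next
    case False
    then have "realizes fail ins k b (Proj i)" by (auto simp: realizes_def rrun_fail *)
    then show ?thesis ..
  qed
next
  case (Comp f gs)
  show ?case by (rule realizes_Comp) (use Comp in blast)+
next
  case (PrimRec f g)
  show ?case
  proof (cases ins)
    case Nil
    have "\<not> rec_eval (PrimRec f g) [] y" for y by (auto elim: rec_eval.cases)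
    then have "realizes fail ins k b (PrimRec f g)" using Nil by (auto simp: realizes_def rrun_fail)
    then show ?thesis ..
  next
    case (Cons i ins')
    show ?thesis unfolding Cons
      by (rule realizes_PrimRec) (use PrimRec Cons in blast)+
  qed
next
  case (Mu f)
  show ?case by (rule realizes_Mu) (use Mu in blast)+
qed

section \<open>Simulation by two counters\<close>

datatype ctr_act = Add int int | Test int int

text \<open>\<open>Test i j\<close> is passed by those counter values from which \<open>(i, j)\<close> cannot be added: in the game
  this is what keeps the second player from a profitable deviation. A zero test of the first
  counter is \<open>Test (-1) 0\<close>.\<close>

primrec ctr_sem :: "ctr_act \<Rightarrow> nat \<times> nat \<Rightarrow> (nat \<times> nat) set" where
  "ctr_sem (Add i j) c = {d. int (fst d) = int (fst c) + i \<and> int (snd d) = int (snd c) + j}"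
| "ctr_sem (Test i j) c = (if int (fst c) + i \<ge> 0 \<and> int (snd c) + j \<ge> 0 then {} else {c})"

abbreviation crun :: "ctr_act prog \<Rightarrow> nat \<times> nat \<Rightarrow> (nat \<times> nat) set" where
  "crun \<equiv> run ctr_sem"

text \<open>The counters move along a straight line, so values that are non-negative at both ends
  are non-negative in between, and every round can be executed.\<close>

lemma crun_Star_Add:
  "crun (Star (Act (Add i j))) c =
    {d. \<exists>q::nat. int (fst d) = int (fst c) + int q * i \<and> int (snd d) = int (snd c) + int q * j}"
  (is "_ = {d. \<exists>q. ?step q d}")
proof
  show "crun (Star (Act (Add i j))) c \<subseteq> {d. \<exists>q. ?step q d}"
  proof (rule run_Star_least)
    show "c \<in> {d. \<exists>q. ?step q d}" by (auto intro: exI[of _ 0])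
    fix d assume "d \<in> {d. \<exists>q. ?step q d}"
    then obtain q where "?step q d" by blast
    then have "?step (Suc q) e" if "e \<in> crun (Act (Add i j)) d" for e
      using that by (simp add: algebra_simps)
    then show "crun (Act (Add i j)) d \<subseteq> {d. \<exists>q. ?step q d}" by blast
  qed
  have "d \<in> crun (Star (Act (Add i j))) c" if "?step q d" for q d
    using that
  proof (induction q arbitrary: d)
    case 0
    then have "d = c" by (simp add: prod_eq_iff)
    then show ?case by (simp add: run_Star_refl)
  next
    case (Suc q)
    have conv: "0 \<le> x + int q * k" if "0 \<le> x" "0 \<le> x + int (Suc q) * k" for x k :: int
    proof (cases "k \<ge> 0")
      case True
      then show ?thesis using that by simp
    next
      case False
      then show ?thesis using that by (simp add: algebra_simps)
    qed
    define e where "e = (nat (int (fst c) + int q * i), nat (int (snd c) + int q * j))"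
    have "0 \<le> int (fst c) + int (Suc q) * i" "0 \<le> int (snd c) + int (Suc q) * j"
      using Suc.prems by linarith+
    then have e: "int (fst e) = int (fst c) + int q * i" "int (snd e) = int (snd c) + int q * j"
      using conv by (simp_all add: e_def)
    then have "d \<in> crun (Act (Add i j)) e"
      using Suc.prems by (simp add: algebra_simps)
    then show ?case using Suc.IH[of e] e run_Star_snoc by metis
  qed
  then show "{d. \<exists>q. ?step q d} \<subseteq> crun (Star (Act (Add i j))) c" by blast
qed

definition drain :: "nat \<Rightarrow> nat \<Rightarrow> ctr_act prog" where
  "drain a b = Star (Act (Add (- int a) (int b)))"

lemma crun_drain: "crun (drain a b) (x, y) = {(x', y + q * b) | x' q. x = x' + q * a}"
proof -
  have "int x' = int x + int q * - int a \<longleftrightarrow> x = x' + q * a" for x' q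
    by (simp flip: of_nat_mult of_nat_add) linarith
  moreover have "int y' = int y + int q * int b \<longleftrightarrow> y' = y + q * b" for y' q
    by (simp flip: of_nat_mult of_nat_add)
  ultimately show ?thesis by (auto simp: drain_def crun_Star_Add)
qed

definition refill :: "ctr_act prog" where
  "refill = Seq (Star (Act (Add 1 (- 1)))) (Act (Test 0 (- 1)))"

lemma crun_refill: "crun refill (x, y) = {(x + y, 0)}"
  by (auto simp: refill_def crun_Star_Add intro!: exI[of _ y] split: if_splits)

definition multiply :: "nat \<Rightarrow> ctr_act prog" where
  "multiply p = Seq (drain 1 p) (Seq (Act (Test (- 1) 0)) refill)"

lemma crun_multiply: "crun (multiply p) (n, 0) = {(n * p, 0)}"
  by (auto simp: multiply_def crun_drain crun_refill split: if_splits)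

definition divide :: "nat \<Rightarrow> ctr_act prog" where
  "divide p = Seq (drain p 1) (Seq (Act (Test (- 1) 0)) refill)"

text \<open>Draining stops at an arbitrary moment, but the zero test demands that nothing is left,
  which is possible only for a multiple of \<open>p\<close>. The second counter then holds the
  quotient.\<close>

lemma crun_divide:
  "p > 0 \<Longrightarrow> crun (divide p) (n, 0) = (if p dvd n then {(n div p, 0)} else {})"
  by (auto simp: divide_def crun_drain crun_refill elim!: dvdE split: if_splits)

definition nondivisible :: "nat \<Rightarrow> ctr_act prog" where
  "nondivisible p = Seq (drain p p) (Seq (Act (Test (- int p) 0)) (Seq (Act (Add (- 1) 1))
    (Seq (drain 1 1) (Seq (Act (Test (- 1) 0)) refill))))"

text \<open>\<open>Test (-p) 0\<close> admits only values less than \<open>p\<close>, so the drain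
  must have stopped at the remainder \<open>n mod p\<close>. \<open>Add (-1) 1\<close> is blocked
  exactly if this remainder is zero; what follows merely restores \<open>n\<close>.\<close>

lemma crun_nondivisible:
  assumes "p > 0"
  shows "crun (nondivisible p) (n, 0) = (if p dvd n then {} else {(n, 0)})"
proof -
  have "crun (Seq (drain 1 1) (Seq (Act (Test (- 1) 0)) refill)) (x, y) = {(x + y, 0)}" for x y
    by (auto simp: crun_drain crun_refill split: if_splits)
  then have rest: "crun (Seq (Act (Add (- 1) 1)) (Seq (drain 1 1) (Seq (Act (Test (- 1) 0)) refill))) (x, y) =
      (if x = 0 then {} else {(x + y, 0)})" for x y
    by (cases x) (auto simp: run.simps(2)[of _ "Act (Add (- 1) 1)"] simp del: run.simps(2))
  have "crun (Seq (drain p p) (Act (Test (- int p) 0))) (n, 0) = {(n mod p, n div p * p)}"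
  proof -
    have "x = n mod p \<and> q = n div p" if "n = x + q * p" "x < p" for x q
      using that by simp
    moreover have "n = n mod p + n div p * p" "n mod p < p"
      using assms by simp_all
    ultimately show ?thesis
      by (auto simp: crun_drain split: if_splits)
  qed
  moreover have "crun (nondivisible p) (n, 0) =
      (\<Union>c\<in>crun (Seq (drain p p) (Act (Test (- int p) 0))) (n, 0).
        crun (Seq (Act (Add (- 1) 1)) (Seq (drain 1 1) (Seq (Act (Test (- 1) 0)) refill))) c)"
    unfolding nondivisible_def run.simps(2) by blast
  ultimately show ?thesis
    by (simp only: UN_insert UN_empty Un_empty_right rest) (simp add: dvd_eq_mod_eq_0)
qed

section \<open>Implementing registers by exponents of primes\<close>

primrec subst :: "('a \<Rightarrow> 'b prog) \<Rightarrow> 'a prog \<Rightarrow> 'b prog" where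
  "subst h (Act a) = h a"
| "subst h (Seq P Q) = Seq (subst h P) (subst h Q)"
| "subst h (Star P) = Star (subst h P)"

text \<open>For \<open>Star\<close>, both inclusions come from the invariant rule: once with the
  image under \<open>E\<close> of the states reached, once with the preimage. The assumption
  concerns only actions occurring in \<open>P\<close>, as the Goedel number covers only finitely
  many registers.\<close>

lemma run_subst:
  assumes "\<And>a v. a \<in> set_prog P \<Longrightarrow> run B (h a) (E v) = E ` A a v"
  shows "run B (subst h P) (E v) = E ` run A P v"
  using assms
proof (induction P arbitrary: v)
  case (Act a)
  then show ?case by simp
next
  case (Seq P Q)
  then show ?case by (simp add: image_UN)
next
  case (Star P)
  have IH: "run B (subst h P) (E w) = E ` run A P w" for w
    using Star by simp
  have "run B (Star (subst h P)) (E v) \<subseteq> E ` run A (Star P) v"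
  proof (rule run_Star_least)
    fix x assume "x \<in> E ` run A (Star P) v"
    then obtain w where "x = E w" "w \<in> run A (Star P) v" by blast
    then show "run B (subst h P) x \<subseteq> E ` run A (Star P) v"
      using IH run_Star_snoc[of w A P v] by auto
  qed (simp add: run_Star_refl)
  moreover have "run A (Star P) v \<subseteq> {w. E w \<in> run B (Star (subst h P)) (E v)}"
    by (rule run_Star_least) (use IH run_Star_refl run_Star_snoc in fast)+
  ultimately show ?case by auto
qed

definition nth_prime :: "nat \<Rightarrow> nat" where
  "nth_prime = enumerate {p. prime p}"

lemma prime_nth_prime: "prime (nth_prime i)"
  using enumerate_in_set[OF primes_infinite, of i] by (simp add: nth_prime_def)

lemma nth_prime_pos: "nth_prime i > 0"
  using prime_nth_prime prime_gt_0_nat by blast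

lemma nth_prime_eq_iff: "nth_prime i = nth_prime k \<longleftrightarrow> i = k"
  using strict_mono_enumerate[OF primes_infinite] by (simp add: nth_prime_def strict_mono_eq)

definition goedel :: "nat \<Rightarrow> store \<Rightarrow> nat" where
  "goedel K v = (\<Prod>i<K. nth_prime i ^ v i)"

lemma goedel_upd:
  assumes "i < K"
  shows "goedel K (v(i := n)) = nth_prime i ^ n * (\<Prod>j\<in>{..<K} - {i}. nth_prime j ^ v j)"
proof -
  have "goedel K (v(i := n)) = nth_prime i ^ n * (\<Prod>j\<in>{..<K} - {i}. nth_prime j ^ (v(i := n)) j)"
    using assms by (simp add: goedel_def prod.remove[of _ i])
  also have "(\<Prod>j\<in>{..<K} - {i}. nth_prime j ^ (v(i := n)) j) = (\<Prod>j\<in>{..<K} - {i}. nth_prime j ^ v j)"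
    by (intro prod.cong) auto
  finally show ?thesis .
qed

lemma goedel_Suc: "i < K \<Longrightarrow> goedel K (v(i := Suc n)) = goedel K (v(i := n)) * nth_prime i"
  by (simp add: goedel_upd)

lemma nth_prime_dvd_goedel:
  assumes "i < K"
  shows "nth_prime i dvd goedel K v \<longleftrightarrow> v i > 0"
proof -
  have "nth_prime i dvd goedel K v \<longleftrightarrow> (\<exists>j<K. nth_prime i dvd nth_prime j ^ v j)"
    using prime_nth_prime by (auto simp: goedel_def prime_dvd_prod_iff)
  also have "\<dots> \<longleftrightarrow> v i > 0"
    using assms prime_nth_prime
    by (metis dvd_refl gr0I nth_prime_eq_iff power_0 prime_dvd_power primes_dvd_imp_eq
        dvd_power not_prime_unit)
  finally show ?thesis .
qed

primrec impl :: "reg_act \<Rightarrow> ctr_act prog" where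
  "impl (Inc i) = multiply (nth_prime i)"
| "impl (Dec i) = divide (nth_prime i)"
| "impl (Tst i) = nondivisible (nth_prime i)"

primrec reg :: "reg_act \<Rightarrow> nat" where
  "reg (Inc i) = i"
| "reg (Dec i) = i"
| "reg (Tst i) = i"

lemma crun_impl:
  assumes "reg a < K"
  shows "crun (impl a) (goedel K v, 0) = (\<lambda>w. (goedel K w, 0)) ` reg_sem a v"
proof (cases a)
  case (Inc i)
  then show ?thesis using assms goedel_Suc[of i K v "v i"] by (simp add: crun_multiply)
next
  case (Dec i)
  show ?thesis
  proof (cases "v i")
    case 0
    then show ?thesis
      using Dec assms nth_prime_dvd_goedel[of i K v] by (simp add: crun_divide nth_prime_pos)
  next
    case (Suc n)
    then have "goedel K v = goedel K (v(i := n)) * nth_prime i"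
      using Dec assms goedel_Suc[of i K v n] by (metis fun_upd_triv reg.simps(2))
    then show ?thesis
      using Dec Suc nth_prime_pos[of i] by (simp add: crun_divide)
  qed
next
  case (Tst i)
  then show ?thesis
    using assms nth_prime_dvd_goedel[of i K v] by (simp add: crun_nondivisible nth_prime_pos)
qed

lemma reg_bound: "\<exists>K. \<forall>a\<in>set_prog P. reg a < K"
proof (induction P)
  case (Act a)
  then show ?case by auto
next
  case (Seq P Q)
  then obtain K L where "\<forall>a\<in>set_prog P. reg a < K" "\<forall>a\<in>set_prog Q. reg a < L" by blast
  then show ?case by (intro exI[of _ "max K L"]) auto
next
  case (Star P)
  then show ?case by simp
qed

definition input :: "nat \<Rightarrow> nat \<Rightarrow> nat" where
  "input x y = nth_prime 0 ^ x * nth_prime 1 ^ y"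

text \<open>Acceptance means that some run can be completed, so divergence of \<open>g\<close> and a
  nonzero result are both rejections.\<close>

lemma counter_program:
  "\<exists>Q. \<forall>x y. crun Q (input x y, 0) \<noteq> {} \<longleftrightarrow> rec_eval g [x, y] 0"
proof -
  obtain P where P: "realizes P [0, 1] 2 3 g"
    using rec_eval_realizable[of "[0, 1]" 3 2 g] by auto
  define P' where "P' = Seq P (Act (Tst 2))"
  obtain K0 where "\<forall>a\<in>set_prog P'. reg a < K0"
    using reg_bound by blast
  \<comment> \<open>The bound is at least 2 so that the product includes both input registers even
    if the program never touches them.\<close>
  then obtain K where K: "\<forall>a\<in>set_prog P'. reg a < K" "K \<ge> 2"
    by (metis le_max_iff_disj less_le_trans linorder_le_cases max.cobounded1 max.cobounded2)
  have "crun (subst impl P') (input x y, 0) \<noteq> {} \<longleftrightarrow> rec_eval g [x, y] 0" for x y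
  proof -
    define v :: store where "v = (\<lambda>_. 0)(0 := x, 1 := y)"
    have "{..<K} = {0, 1} \<union> {2..<K}" using K(2) by auto
    then have "goedel K v = (\<Prod>i\<in>{0, 1}. nth_prime i ^ v i) * (\<Prod>i\<in>{2..<K}. nth_prime i ^ v i)"
      unfolding goedel_def by (subst prod.union_disjoint[symmetric]) auto
    then have "goedel K v = input x y" by (simp add: v_def input_def)
    moreover have "crun (subst impl P') (goedel K v, 0) = (\<lambda>w. (goedel K w, 0)) ` rrun P' v"
      using K(1) crun_impl by (intro run_subst[where E = "\<lambda>w. (goedel K w, 0)"]) blast
    moreover have "rrun P v = {v(2 := z) | z. rec_eval g [x, y] z}"
      using realizesD[OF P, of v] by (simp add: v_def)
    then have "rrun P' v \<noteq> {} \<longleftrightarrow> rec_eval g [x, y] 0"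
      by (auto simp: P'_def split: if_splits)
    ultimately show ?thesis by simp
  qed
  then show ?thesis by blast
qed

section \<open>Programs as automata\<close>

type_synonym transition = "nat \<times> ctr_act \<times> nat"

inductive step :: "transition list \<Rightarrow> nat \<times> nat \<times> nat \<Rightarrow> nat \<times> nat \<times> nat \<Rightarrow> bool" for ts where
  "(s, a, t) \<in> set ts \<Longrightarrow> d \<in> ctr_sem a c \<Longrightarrow> step ts (s, c) (t, d)"

primrec fresh :: "'a prog \<Rightarrow> nat" where
  "fresh (Act a) = 0"
| "fresh (Seq P Q) = Suc (fresh P + fresh Q)"
| "fresh (Star P) = Suc (fresh P)"

text \<open>The automaton of \<open>P\<close> from state \<open>s\<close> to state \<open>e\<close>, with inner states
  \<open>f, \<dots>, f + fresh P - 1\<close>.\<close>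

primrec transitions :: "ctr_act prog \<Rightarrow> nat \<Rightarrow> nat \<Rightarrow> nat \<Rightarrow> transition list" where
  "transitions (Act a) s e f = [(s, a, e)]"
| "transitions (Seq P Q) s e f =
    transitions P s f (Suc f) @ transitions Q f e (Suc f + fresh P)"
| "transitions (Star P) s e f =
    (s, Add 0 0, f) # (f, Add 0 0, e) # transitions P f f (Suc f)"

lemma transitions_states:
  assumes "(u, a, w) \<in> set (transitions P s e f)"
  shows "(u = s \<or> f \<le> u \<and> u < f + fresh P) \<and> (w = e \<or> f \<le> w \<and> w < f + fresh P)"
  using assms
proof (induction P arbitrary: s e f)
  case (Seq P Q)
  then show ?case by (fastforce simp del: Un_iff simp: set_append Un_def)
next
  case (Star P)
  then show ?case by fastforce
qed auto

lemma step_mono: "set ts \<subseteq> set us \<Longrightarrow> (step ts)\<^sup>*\<^sup>* x y \<Longrightarrow> (step us)\<^sup>*\<^sup>* x y"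
  by (erule rtranclp_mono[THEN predicate2D, rotated]) (auto elim!: step.cases intro: step.intros)

lemma transitions_complete:
  "d \<in> crun P c \<Longrightarrow> (step (transitions P s e f))\<^sup>*\<^sup>* (s, c) (e, d)"
proof (induction P arbitrary: s e f c d)
  case (Act a)
  then have "step (transitions (Act a) s e f) (s, c) (e, d)" by (auto intro: step.intros)
  then show ?case by (rule r_into_rtranclp)
next
  case (Seq P Q)
  let ?T = "transitions (Seq P Q) s e f"
  obtain b where b: "b \<in> crun P c" "d \<in> crun Q b" using Seq.prems by auto
  have "(step ?T)\<^sup>*\<^sup>* (s, c) (f, b)"
    by (rule step_mono[OF _ Seq.IH(1)[OF b(1), of s f "Suc f"]]) simp
  moreover have "(step ?T)\<^sup>*\<^sup>* (f, b) (e, d)"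
    by (rule step_mono[OF _ Seq.IH(2)[OF b(2), of f e "Suc f + fresh P"]]) simp
  ultimately show ?case by (rule rtranclp_trans)
next
  case (Star P)
  let ?T = "transitions (Star P) s e f"
  have first: "step ?T (s, c) (f, c)" and last: "step ?T (f, d) (e, d)"
    by (auto intro!: step.intros)
  have "crun (Star P) c \<subseteq> {d. (step ?T)\<^sup>*\<^sup>* (f, c) (f, d)}"
  proof (rule run_Star_least)
    fix b assume b: "b \<in> {d. (step ?T)\<^sup>*\<^sup>* (f, c) (f, d)}"
    have "(step ?T)\<^sup>*\<^sup>* (f, b) (f, d)" if "d \<in> crun P b" for d
      by (rule step_mono[OF _ Star.IH[OF that, of f f "Suc f"]]) auto
    then show "crun P b \<subseteq> {d. (step ?T)\<^sup>*\<^sup>* (f, c) (f, d)}"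
      using b by (auto intro: rtranclp_trans)
  qed simp
  then have "(step ?T)\<^sup>*\<^sup>* (f, c) (f, d)" using Star.prems by blast
  then have "(step ?T)\<^sup>*\<^sup>* (s, c) (f, d)" using first by (rule converse_rtranclp_into_rtranclp[rotated])
  then show ?case using last by (rule rtranclp.rtrancl_into_rtrancl)
qed

text \<open>Soundness is by annotating every state with the set of counter values that may occur there.\<close>

definition inductive_on :: "transition list \<Rightarrow> (nat \<Rightarrow> (nat \<times> nat) set) \<Rightarrow> bool" where
  "inductive_on ts X \<longleftrightarrow> (\<forall>(u, a, w)\<in>set ts. \<forall>c\<in>X u. ctr_sem a c \<subseteq> X w)"

text \<open>The annotation is prescribed only on the inner states; at the two ends it is merely
  bounded by \<open>S\<close> and \<open>E\<close>. Therefore annotations of subprograms, whose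
  inner states are disjoint, can be glued. At the inner state shared by two parts, or at a loop
  head, it is the exact set \<open>M\<close> of values produced so far.\<close>

lemma transitions_annotation:
  assumes "\<And>c. c \<in> S \<Longrightarrow> crun P c \<subseteq> E"
  shows "\<exists>Y. \<forall>X. (\<forall>u. f \<le> u \<and> u < f + fresh P \<longrightarrow> X u = Y u) \<longrightarrow> X s \<subseteq> S \<longrightarrow> E \<subseteq> X e \<longrightarrow>
    inductive_on (transitions P s e f) X"
  using assms
proof (induction P arbitrary: s e f S E)
  case (Act a)
  have "inductive_on (transitions (Act a) s e f) X" if "X s \<subseteq> S" "E \<subseteq> X e" for X
    using Act that by (fastforce simp: inductive_on_def)
  then show ?case by blast
next
  case (Seq P Q)
  define M where "M = (\<Union>c\<in>S. crun P c)"
  obtain Y1 where Y1: "\<forall>X. (\<forall>u. Suc f \<le> u \<and> u < Suc f + fresh P \<longrightarrow> X u = Y1 u) \<longrightarrow>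
      X s \<subseteq> S \<longrightarrow> M \<subseteq> X f \<longrightarrow> inductive_on (transitions P s f (Suc f)) X"
    using Seq.IH(1)[of S M "Suc f" s f] unfolding M_def by blast
  have "crun Q c \<subseteq> E" if "c \<in> M" for c using that Seq.prems by (auto simp: M_def)
  then obtain Y2 where Y2: "\<forall>X. (\<forall>u. Suc f + fresh P \<le> u \<and> u < Suc f + fresh P + fresh Q \<longrightarrow>
      X u = Y2 u) \<longrightarrow> X f \<subseteq> M \<longrightarrow> E \<subseteq> X e \<longrightarrow>
      inductive_on (transitions Q f e (Suc f + fresh P)) X"
    using Seq.IH(2)[of M E "Suc f + fresh P" f e] by blast
  define Y where "Y u = (if u = f then M else if u < Suc f + fresh P then Y1 u else Y2 u)" for u
  show ?case
  proof (intro exI[of _ Y] allI impI)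
    fix X assume X: "\<forall>u. f \<le> u \<and> u < f + fresh (Seq P Q) \<longrightarrow> X u = Y u" "X s \<subseteq> S" "E \<subseteq> X e"
    have "X f = M" using X(1) by (simp add: Y_def)
    moreover have "X u = Y1 u" if "Suc f \<le> u" "u < Suc f + fresh P" for u
      using X(1) that by (simp add: Y_def)
    moreover have "X u = Y2 u" if "Suc f + fresh P \<le> u" "u < Suc f + fresh P + fresh Q" for u
      using X(1) that by (simp add: Y_def)
    ultimately have "inductive_on (transitions P s f (Suc f)) X"
      "inductive_on (transitions Q f e (Suc f + fresh P)) X"
      using Y1 Y2 X(2,3) by simp_all
    then show "inductive_on (transitions (Seq P Q) s e f) X"
      unfolding inductive_on_def transitions.simps set_append ball_Un by (rule conjI)
  qed
next
  case (Star P)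
  define M where "M = (\<Union>c\<in>S. crun (Star P) c)"
  have "crun P c \<subseteq> M" if "c \<in> M" for c
    using that run_Star_snoc unfolding M_def by fast
  then obtain Y1 where Y1: "\<forall>X. (\<forall>u. Suc f \<le> u \<and> u < Suc f + fresh P \<longrightarrow> X u = Y1 u) \<longrightarrow>
      X f \<subseteq> M \<longrightarrow> M \<subseteq> X f \<longrightarrow> inductive_on (transitions P f f (Suc f)) X"
    using Star.IH[of M M "Suc f" f f] by blast
  have S: "S \<subseteq> M" using run_Star_refl unfolding M_def by fast
  have E: "M \<subseteq> E" using Star.prems unfolding M_def by blast
  show ?case
  proof (intro exI[of _ "Y1(f := M)"] allI impI)
    fix X assume X: "\<forall>u. f \<le> u \<and> u < f + fresh (Star P) \<longrightarrow> X u = (Y1(f := M)) u"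
      "X s \<subseteq> S" "E \<subseteq> X e"
    have f: "X f = M" using X(1) by simp
    have "inductive_on (transitions P f f (Suc f)) X"
      using Y1 X(1) f by simp
    then show "inductive_on (transitions (Star P) s e f) X"
      using X(2,3) S E f by (fastforce simp: inductive_on_def)
  qed
qed

lemma transitions_sound:
  assumes "(step (transitions P s e f))\<^sup>*\<^sup>* (s, c) (e, d)" "s \<noteq> e" "s < f" "e < f"
  shows "d \<in> crun P c"
proof -
  obtain Y where Y: "\<forall>X. (\<forall>u. f \<le> u \<and> u < f + fresh P \<longrightarrow> X u = Y u) \<longrightarrow> X s \<subseteq> {c} \<longrightarrow>
      crun P c \<subseteq> X e \<longrightarrow> inductive_on (transitions P s e f) X"
    using transitions_annotation[of "{c}" P "crun P c" f s e] by auto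
  \<comment> \<open>Start, end and inner states are pairwise different by assumption, so these
    updates do not clash with each other or with \<open>Y\<close>.\<close>
  define X where "X = Y(s := {c}, e := crun P c)"
  have X: "inductive_on (transitions P s e f) X"
    using Y assms(2-) by (simp add: X_def)
  have "d \<in> X t" if "(step (transitions P s e f))\<^sup>*\<^sup>* (s, c) (t, d)" for t d
    using that
  proof (induction rule: rtranclp_induct2)
    case refl
    then show ?case using assms(2) by (simp add: X_def)
  next
    case (step t d t' d')
    then show ?case using X unfolding inductive_on_def by (blast elim: step.cases)
  qed
  from this[OF assms(1)] show ?thesis by (simp add: X_def)
qed

section \<open>The game of a counter automaton\<close>

lemma length_prefix [simp]: "length (prefix \<rho> m) = Suc m"
  by (simp add: prefix_def)

lemma last_prefix [simp]: "last (prefix \<rho> m) = \<rho> m"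
  by (simp add: prefix_def)

lemma prefix_cong: "(\<And>j. j \<le> m \<Longrightarrow> \<rho> j = \<rho>' j) \<Longrightarrow> prefix \<rho> m = prefix \<rho>' m"
  by (simp add: prefix_def)

lemma prefix_eqD: "prefix \<rho> m = prefix \<rho>' m \<Longrightarrow> j \<le> m \<Longrightarrow> \<rho> j = \<rho>' j"
  by (auto simp: prefix_def le_less)

lemma history_cost_prefix_0: "history_cost c (prefix \<rho> 0) k = 0"
  by (simp add: history_cost_def)

lemma history_cost_prefix_Suc:
  "history_cost c (prefix \<rho> (Suc m)) k = history_cost c (prefix \<rho> m) k + c (\<rho> m, \<rho> (Suc m)) k"
proof -
  have nth: "prefix \<rho> m ! j = \<rho> j" if "j \<le> m" for m j
    using that by (simp add: prefix_def nth_append del: upt_Suc)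
  then show ?thesis by (simp add: history_cost_def)
qed

lemma prefix_in_histories: "\<rho> \<in> plays G \<Longrightarrow> prefix \<rho> m \<in> histories G"
  unfolding histories_def by blast

lemma outcome_eqI:
  "wf_arena G \<Longrightarrow> is_profile G \<sigma> \<Longrightarrow> \<rho> \<in> plays G \<Longrightarrow> follows G \<sigma> \<rho> \<Longrightarrow> outcome G \<sigma> = \<rho>"
  unfolding outcome_def by (rule the1_equality[OF outcome_ex1]) auto

lemma
  assumes "wf_arena G" "is_profile G \<sigma>"
  shows outcome_in_plays: "outcome G \<sigma> \<in> plays G" and follows_outcome: "follows G \<sigma> (outcome G \<sigma>)"
  using theI'[OF outcome_ex1[OF assms]] unfolding outcome_def by auto

text \<open>The prefix with index \<open>m\<close> has length \<open>m + 1\<close>, hence the shift.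
  Off the play any legal move is taken: nobody has to be punished, as a diversion from an honest
  play costs too much by itself.\<close>

definition play_strategy :: "('s, 'p, 'm) arena_scheme \<Rightarrow> 's play \<Rightarrow> 's strategy" where
  "play_strategy G \<rho> h =
    (if h = prefix \<rho> (length h - 1) then \<rho> (length h) else SOME t. (last h, t) \<in> edges G)"

lemma play_strategy_prefix: "play_strategy G \<rho> (prefix \<rho> m) = \<rho> (Suc m)"
  by (simp add: play_strategy_def)

lemma is_strategy_play_strategy:
  assumes "wf_arena G" "\<rho> \<in> plays G"
  shows "is_strategy G i (play_strategy G \<rho>)"
  unfolding is_strategy_def
proof (intro ballI impI)
  fix h assume "h \<in> histories G"
  then obtain \<rho>' m where h: "h = prefix \<rho>' m" "\<rho>' \<in> plays G" by (auto simp: histories_def)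
  then have "\<exists>t. (last h, t) \<in> edges G" by (auto simp: plays_def)
  then have "(last h, SOME t. (last h, t) \<in> edges G) \<in> edges G" by (rule someI_ex)
  moreover have "(\<rho> m, \<rho> (Suc m)) \<in> edges G" using assms(2) by (simp add: plays_def)
  ultimately show "(last h, play_strategy G \<rho> h) \<in> edges G"
    using h(1) by (auto simp: play_strategy_def dest: prefix_eqD)
qed

section \<open>Construction and basic properties of the game\<close>

primrec owner :: "ctr_act \<Rightarrow> nat" where
  "owner (Add i j) = 1"
| "owner (Test i j) = 2"

text \<open>A separate middle state per transition keeps parallel transitions apart in an edge
  relation, and it gives player 2 a place to decide about a test. An addition is paid on entering,
  so in the middle state the transition counts as executed.\<close>

fun transition_edges :: "nat \<Rightarrow> transition \<Rightarrow> ((nat \<times> nat) \<times> int list) list" where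
  "transition_edges m (u, Add i j, w) = [((u, m), [i, j]), ((m, w), [0, 0])]"
| "transition_edges m (u, Test i j, w) = [((u, m), [0, 0]), ((m, w), [0, 0]), ((m, 1), [i, j])]"

definition game_states :: "nat \<Rightarrow> transition list \<Rightarrow> (nat \<times> nat list) list" where
  "game_states N ts = replicate N (1, []) @ map (\<lambda>(u, a, w). (owner a, [])) ts"

text \<open>The free loops make states 1 and 2 sinks and give every state of the automaton a
  successor. The edge out of state 0 is left out because it alone depends on the input, which
  contains the code of this list.\<close>

definition game_edges :: "nat \<Rightarrow> transition list \<Rightarrow> ((nat \<times> nat) \<times> int list) list" where
  "game_edges N ts = map (\<lambda>u. ((u, u), [0, 0])) [1..<N] @
    concat (map (\<lambda>k. transition_edges (N + k) (ts ! k)) [0..<length ts])"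

text \<open>State 0 is initial and charges the first counter with \<open>x\<close>; state 1 is the sink that player 2
  wants to reach, state 2 the sink of the specification, and the automaton starts in state 3. The
  \<open>k\<close>-th transition passes through the state \<open>N + k\<close>, where player 2 can divert a test to state 1.
  Player 1 has an objective that cannot be met.\<close>

definition game :: "nat \<Rightarrow> transition list \<Rightarrow> nat \<Rightarrow> game_instance" where
  "game N ts x =
    \<lparr> inst_players = 2, inst_states = game_states N ts, inst_init = 0, inst_props = 0, inst_dim = 2,
      inst_edges = ((0, 3), [int x, 0]) # game_edges N ts,
      inst_objs = [Reachability [], Reachability [1]], inst_spec = Reachability [2] \<rparr>"

text \<open>No transition leaves the states 0, 1 and 2, and none enters 0 or 1; hence state 1 can be
  entered from elsewhere only by diverting a test.\<close>

locale counter_game =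
  fixes N :: nat and ts :: "transition list" and x :: nat
  assumes N: "N \<ge> 4"
    and ts: "\<And>u a w. (u, a, w) \<in> set ts \<Longrightarrow> 3 \<le> u \<and> u < N \<and> 2 \<le> w \<and> w < N"
begin

abbreviation G :: "(nat, nat) arena" where "G \<equiv> arena_of (game N ts x)"
abbreviation C :: "nat cost_fun" where "C \<equiv> cost_of (game N ts x)"
abbreviation ME :: "nat play set" where "ME \<equiv> multi_energy G 2 C"

lemma ts_nth: "k < length ts \<Longrightarrow> ts ! k = (u, a, w) \<Longrightarrow> 3 \<le> u \<and> u < N \<and> 2 \<le> w \<and> w < N"
  using ts nth_mem by metis

lemma G_simps [simp]:
  "states G = {..<N + length ts}" "num_players G = 2" "init G = 0" "props G = {}"
  "label G = (\<lambda>s. set (snd (game_states N ts ! s)))"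
  by (simp_all add: arena_of_def game_def game_states_def)

lemma ctrl_main: "s < N \<Longrightarrow> s \<in> ctrl G i \<longleftrightarrow> i = 1"
  by (auto simp: arena_of_def game_def game_states_def nth_append)

lemma ctrl_mid: "k < length ts \<Longrightarrow> ts ! k = (u, a, w) \<Longrightarrow> N + k \<in> ctrl G i \<longleftrightarrow> i = owner a"
  by (auto simp: arena_of_def game_def game_states_def nth_append)

lemma ctrl_subset: "ctrl G i \<subseteq> states G"
  by (auto simp: arena_of_def game_def game_states_def)

lemma set_game_edges:
  "set (inst_edges (game N ts x)) = insert ((0, 3), [int x, 0])
    ((\<lambda>u. ((u, u), [0, 0])) ` {1..<N} \<union> (\<Union>k<length ts. set (transition_edges (N + k) (ts ! k))))"
  by (auto simp: game_def game_edges_def)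

lemma transition_edges_cases:
  assumes "(e, v) \<in> set (transition_edges m (u, a, w))"
  obtains "e = (u, m)" | "e = (m, w)" | i j where "a = Test i j" "e = (m, 1)"
  using assms by (cases a) auto

text \<open>Every edge contributed by a transition touches the middle state of that transition,
  which occurs in no earlier edge; \<open>2 \<le> w\<close> separates leaving from diverting. No
  edge of \<open>game_edges\<close> touches state 0.\<close>

lemma distinct_edges: "distinct (map fst (inst_edges (game N ts x)))"
proof -
  have "distinct (map fst (game_edges N ss)) \<and>
      fst ` set (game_edges N ss) \<subseteq> {1..<N + length ss} \<times> {1..<N + length ss}"
    if "\<And>u a w. (u, a, w) \<in> set ss \<Longrightarrow> 3 \<le> u \<and> u < N \<and> 2 \<le> w \<and> w < N" for ss :: "transition list"
    using that
  proof (induction ss rule: rev_induct)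
    case Nil
    then show ?case by (auto simp: game_edges_def distinct_map inj_on_def)
  next
    case (snoc t ss)
    obtain u a w where t: "t = (u, a, w)" by (cases t)
    have uw: "3 \<le> u \<and> u < N \<and> 2 \<le> w \<and> w < N" using snoc.prems[of u a w] t by simp
    have "map (\<lambda>k. transition_edges (N + k) ((ss @ [t]) ! k)) [0..<length ss] =
        map (\<lambda>k. transition_edges (N + k) (ss ! k)) [0..<length ss]"
      by (simp add: nth_append)
    then have eq: "game_edges N (ss @ [t]) = game_edges N ss @ transition_edges (N + length ss) t"
      by (simp add: game_edges_def del: map_eq_conv)
    have IH: "distinct (map fst (game_edges N ss))"
      "fst ` set (game_edges N ss) \<subseteq> {1..<N + length ss} \<times> {1..<N + length ss}"
      using snoc.IH snoc.prems by auto
    have "fst ` set (transition_edges (N + length ss) t) \<subseteq>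
        {(p, q). (p = N + length ss \<or> q = N + length ss) \<and> p \<in> {1..N + length ss} \<and> q \<in> {1..N + length ss}}"
      using uw N by (cases a) (auto simp: t)
    moreover have "distinct (map fst (transition_edges (N + length ss) t))"
      using uw by (cases a) (auto simp: t)
    ultimately show ?case
      using IH unfolding eq by fastforce
  qed
  from this[of ts] ts show ?thesis by (auto simp: game_def)
qed

lemma C_eq: "(e, v) \<in> set (inst_edges (game N ts x)) \<Longrightarrow> C e k = v ! k"
  by (simp add: cost_of_def map_of_is_SomeI[OF distinct_edges])

lemma in_edges_iff: "(s, t) \<in> edges G \<longleftrightarrow> (\<exists>v. ((s, t), v) \<in> set (inst_edges (game N ts x)))"
  by (force simp: arena_of_def)

lemma edge_start: "(0, 3) \<in> edges G" "C (0, 3) 0 = int x" "C (0, 3) 1 = 0"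
  using C_eq[of "(0, 3)" "[int x, 0]"] by (auto simp: in_edges_iff set_game_edges)

lemma edge_loop:
  assumes "1 \<le> s" "s < N"
  shows "(s, s) \<in> edges G" "k < 2 \<Longrightarrow> C (s, s) k = 0"
proof -
  have "((s, s), [0, 0]) \<in> set (inst_edges (game N ts x))"
    using assms by (simp add: set_game_edges)
  then show "(s, s) \<in> edges G" "k < 2 \<Longrightarrow> C (s, s) k = 0"
    using C_eq by (auto simp: in_edges_iff less_2_cases_iff)
qed

lemma transition_edge:
  "k < length ts \<Longrightarrow> (e, v) \<in> set (transition_edges (N + k) (ts ! k)) \<Longrightarrow> e \<in> edges G \<and> C e l = v ! l"
  using C_eq[of e v] by (cases e) (auto simp: in_edges_iff set_game_edges)

lemma edge_Add:
  assumes "k < length ts" "ts ! k = (u, Add i j, w)"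
  shows "(u, N + k) \<in> edges G" "C (u, N + k) 0 = i" "C (u, N + k) 1 = j"
  using transition_edge[OF assms(1), of "(u, N + k)" "[i, j]"] assms(2) by auto

lemma edge_Test:
  assumes "k < length ts" "ts ! k = (u, Test i j, w)"
  shows "(u, N + k) \<in> edges G" "l < 2 \<Longrightarrow> C (u, N + k) l = 0"
    "(N + k, 1) \<in> edges G" "C (N + k, 1) 0 = i" "C (N + k, 1) 1 = j"
  using transition_edge[OF assms(1), of "(u, N + k)" "[0, 0]"]
    transition_edge[OF assms(1), of "(N + k, 1)" "[i, j]"] assms(2)
  by (auto simp: less_2_cases_iff)

lemma edge_leave:
  assumes "k < length ts" "ts ! k = (u, a, w)"
  shows "(N + k, w) \<in> edges G" "l < 2 \<Longrightarrow> C (N + k, w) l = 0"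
proof -
  have "((N + k, w), [0, 0]) \<in> set (transition_edges (N + k) (ts ! k))"
    using assms(2) by (cases a) auto
  from transition_edge[OF assms(1) this]
  show "(N + k, w) \<in> edges G" "l < 2 \<Longrightarrow> C (N + k, w) l = 0" by (auto simp: less_2_cases_iff)
qed

lemma edge_cases:
  assumes "(s, t) \<in> edges G"
  obtains (start) "s = 0" "t = 3"
  | (loop) "1 \<le> s" "s < N" "t = s"
  | (enter) k u a w where "k < length ts" "ts ! k = (u, a, w)" "s = u" "t = N + k"
  | (leave) k u a w where "k < length ts" "ts ! k = (u, a, w)" "s = N + k" "t = w"
  | (divert) k u i j w where "k < length ts" "ts ! k = (u, Test i j, w)" "s = N + k" "t = 1"
proof -
  obtain v where "((s, t), v) \<in> set (inst_edges (game N ts x))" using assms by (auto simp: in_edges_iff)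
  then consider "s = 0" "t = 3" | "1 \<le> s" "s < N" "t = s" |
    k where "k < length ts" "((s, t), v) \<in> set (transition_edges (N + k) (ts ! k))"
    by (auto simp: set_game_edges)
  then show thesis
  proof cases
    case (3 k)
    obtain u a w where "ts ! k = (u, a, w)" by (cases "ts ! k")
    then show thesis using 3 enter leave divert
      by (auto elim!: transition_edges_cases)
  qed (use start loop in auto)
qed

lemma edge_into_states: "(s, t) \<in> edges G \<Longrightarrow> s < N + length ts \<and> t < N + length ts"
  by (erule edge_cases) (use N in \<open>auto dest: ts_nth\<close>)

lemma edge_from_sink: "(s, t) \<in> edges G \<Longrightarrow> s = 1 \<or> s = 2 \<Longrightarrow> t = s"
  by (erule edge_cases) (use N in \<open>auto dest: ts_nth\<close>)

lemma edge_from_mid: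
  "(N + k, t) \<in> edges G \<Longrightarrow> k < length ts \<Longrightarrow> ts ! k = (u, a, w) \<Longrightarrow>
    t = w \<or> t = 1 \<and> (\<exists>i j. a = Test i j)"
  by (erule edge_cases) (use N in \<open>auto dest: ts_nth\<close>)

lemma state_cases:
  assumes "s < N + length ts"
  obtains (main) "s < N" | (mid) k u a w where "s = N + k" "k < length ts" "ts ! k = (u, a, w)"
proof (cases "s < N")
  case False
  then have "s = N + (s - N)" "s - N < length ts" using assms by auto
  then show thesis using mid by (cases "ts ! (s - N)") blast
qed (rule main)

lemma wf_G: "wf_arena G"
proof -
  have "\<exists>i\<in>{1..2}. s \<in> ctrl G i" if "s < N + length ts" for s
    using that
  proof (cases rule: state_cases)
    case main
    then have "s \<in> ctrl G 1" by (simp only: ctrl_main)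
    then show ?thesis by (rule bexI) simp
  next
    case (mid k u a w)
    have "owner a \<in> {1..2}" by (cases a) auto
    then show ?thesis using ctrl_mid[OF mid(2,3), of "owner a"] mid(1) by blast
  qed
  then have "states G \<subseteq> (\<Union>i\<in>{1..2}. ctrl G i)" unfolding G_simps by blast
  then have "(\<Union>i\<in>{1..2}. ctrl G i) = states G"
    using UN_least[OF ctrl_subset] by (rule equalityI[rotated])
  moreover have "ctrl G i \<inter> ctrl G j = {}" if "i \<noteq> j" for i j
    using that by (auto simp: arena_of_def)
  moreover have "\<exists>t. (s, t) \<in> edges G" if "s < N + length ts" for s
    using that
  proof (cases rule: state_cases)
    case main
    then show ?thesis using edge_start(1) edge_loop(1)[of s] by (cases "s = 0") auto
  next
    case (mid k u a w)
    then show ?thesis using edge_leave(1) by blast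
  qed
  moreover have "set (snd (game_states N ts ! s)) = {}" if "s < N + length ts" for s
    using that by (auto simp: game_states_def nth_append split: prod.splits)
  ultimately show ?thesis
    using N edge_into_states unfolding wf_arena_def by auto
qed

lemma game_restricted: "game N ts x \<in> restricted_instances"
proof -
  have len: "length (snd p) = 2" if "p \<in> set (transition_edges m t)" for m t p
    using that
    by (cases "(m, t)" rule: transition_edges.cases) auto
  have "\<forall>p\<in>set (inst_edges (game N ts x)). length (snd p) = 2"
    by (simp add: set_game_edges ball_Un len)
  moreover have "inst_dim (game N ts x) = 2" "inst_players (game N ts x) = 2"
    "inst_objs (game N ts x) = [Reachability [], Reachability [1]]"
    "inst_spec (game N ts x) = Reachability [2]"
    by (simp_all add: game_def)
  ultimately show ?thesis
    using wf_G distinct_edges N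
    by (simp add: restricted_instances_def instances_def wf_instance_def is_reachability_def split_beta)
qed

section \<open>Energy along a play; honest plays and runs of the automaton\<close>

definition energy :: "nat play \<Rightarrow> nat \<Rightarrow> int \<times> int" where
  "energy \<rho> m = (history_cost C (prefix \<rho> m) 0, history_cost C (prefix \<rho> m) 1)"

definition nonneg :: "int \<times> int \<Rightarrow> bool" where
  "nonneg e \<longleftrightarrow> fst e \<ge> 0 \<and> snd e \<ge> 0"

lemma energy_0: "energy \<rho> 0 = (0, 0)"
  by (simp add: energy_def history_cost_prefix_0)

lemma energy_Suc:
  "energy \<rho> (Suc m) = (fst (energy \<rho> m) + C (\<rho> m, \<rho> (Suc m)) 0, snd (energy \<rho> m) + C (\<rho> m, \<rho> (Suc m)) 1)"
  by (simp add: energy_def history_cost_prefix_Suc)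

lemma energy_cong: "(\<And>j. j \<le> m \<Longrightarrow> \<rho> j = \<rho>' j) \<Longrightarrow> energy \<rho> m = energy \<rho>' m"
  unfolding energy_def using prefix_cong[of m \<rho> \<rho>'] by simp

lemma ME_iff: "\<rho> \<in> ME \<longleftrightarrow> \<rho> \<in> plays G \<and> (\<forall>m. nonneg (energy \<rho> m))"
  by (auto simp: multi_energy_def energy_def nonneg_def less_2_cases_iff)

text \<open>Player 2 can afford no diversion at any test visited: the counterpart for plays of
  passing every \<open>Test\<close>.\<close>

definition honest :: "nat play \<Rightarrow> bool" where
  "honest \<rho> \<longleftrightarrow> (\<forall>m k u i j w. k < length ts \<longrightarrow> ts ! k = (u, Test i j, w) \<longrightarrow> \<rho> m = N + k \<longrightarrow>
     \<not> nonneg (fst (energy \<rho> m) + i, snd (energy \<rho> m) + j))"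

lemma sink_absorbing:
  assumes "\<rho> \<in> plays G" "\<rho> m = s" "s = 1 \<or> s = 2" "m \<le> n"
  shows "\<rho> n = s"
  using assms(4)
proof (induction n rule: dec_induct)
  case base
  show ?case by (rule assms(2))
next
  case (step n)
  have "(\<rho> n, \<rho> (Suc n)) \<in> edges G" using assms(1) by (simp add: plays_def)
  then show ?case using edge_from_sink step assms(3) by metis
qed

lemma not_both_sinks:
  assumes "\<rho> \<in> plays G" "\<rho> m = 1" "\<rho> n = 2"
  shows False
proof -
  have "\<rho> (max m n) = 1" "\<rho> (max m n) = 2"
    using sink_absorbing[OF assms(1,2), of "max m n"] sink_absorbing[OF assms(1,3), of "max m n"]
    by auto
  then show False by simp
qed

text \<open>At a middle state the invariant already speaks of the target \<open>w\<close>: the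
  counters have been updated on entering, honesty has justified a test, and leaving is free. After a
  diversion the play is in state 1, about which nothing is claimed.\<close>

lemma honest_play_reachable:
  assumes "\<rho> \<in> ME" "honest \<rho>"
  defines "conf m \<equiv> (nat (fst (energy \<rho> m)), nat (snd (energy \<rho> m)))"
  shows "(\<rho> m = 0 \<longrightarrow> energy \<rho> m = (0, 0)) \<and>
    (2 \<le> \<rho> m \<longrightarrow> \<rho> m < N \<longrightarrow> (step ts)\<^sup>*\<^sup>* (3, x, 0) (\<rho> m, conf m)) \<and>
    (\<forall>k u a w. k < length ts \<longrightarrow> ts ! k = (u, a, w) \<longrightarrow> \<rho> m = N + k \<longrightarrow>
      (step ts)\<^sup>*\<^sup>* (3, x, 0) (w, conf m))"
proof (induction m)
  case 0
  have "\<rho> 0 = 0" using assms(1) by (simp add: ME_iff plays_def)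
  then show ?case using N by (simp add: energy_0)
next
  case (Suc m)
  have pos: "nonneg (energy \<rho> l)" for l using assms(1) by (simp add: ME_iff)
  have "(\<rho> m, \<rho> (Suc m)) \<in> edges G" using assms(1) by (simp add: ME_iff plays_def)
  then show ?case
  proof (cases rule: edge_cases)
    case start
    then have "energy \<rho> m = (0, 0)" using Suc.IH by blast
    then have "energy \<rho> (Suc m) = (int x, 0)" using start edge_start by (simp add: energy_Suc)
    then show ?thesis using start N by (simp add: conf_def)
  next
    case loop
    then have "energy \<rho> (Suc m) = energy \<rho> m"
      using edge_loop(2)[of "\<rho> m"] by (simp add: energy_Suc)
    then show ?thesis using loop Suc.IH by (simp add: conf_def)
  next
    case (enter k u a w)
    have u: "3 \<le> u" "u < N" using ts_nth enter by blast+
    then have reach: "(step ts)\<^sup>*\<^sup>* (3, x, 0) (u, conf m)" using Suc.IH enter by auto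
    have "conf (Suc m) \<in> ctr_sem a (conf m)"
    proof (cases a)
      case (Add i j)
      then have "energy \<rho> (Suc m) = (fst (energy \<rho> m) + i, snd (energy \<rho> m) + j)"
        using edge_Add[of k u i j w] enter by (simp add: energy_Suc)
      then show ?thesis using pos[of m] pos[of "Suc m"] Add by (simp add: conf_def nonneg_def)
    next
      case (Test i j)
      then have e: "energy \<rho> (Suc m) = energy \<rho> m"
        using edge_Test(2)[of k u i j w] enter by (simp add: energy_Suc)
      have "\<not> nonneg (fst (energy \<rho> (Suc m)) + i, snd (energy \<rho> (Suc m)) + j)"
        using assms(2) enter Test unfolding honest_def by blast
      then show ?thesis using e pos[of m] Test by (auto simp: conf_def nonneg_def)
    qed
    moreover have "(u, a, w) \<in> set ts" using enter by (metis nth_mem)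
    ultimately have "step ts (u, conf m) (w, conf (Suc m))" by (intro step.intros)
    with reach have "(step ts)\<^sup>*\<^sup>* (3, x, 0) (w, conf (Suc m))" by (rule rtranclp.rtrancl_into_rtrancl)
    then show ?thesis using enter u by auto
  next
    case (leave k u a w)
    then have "energy \<rho> (Suc m) = energy \<rho> m"
      using edge_leave(2)[of k u a w] by (simp add: energy_Suc)
    moreover have "2 \<le> w" "w < N" using ts_nth leave by blast+
    ultimately show ?thesis using leave Suc.IH by (auto simp: conf_def)
  next
    case (divert k u i j w)
    then show ?thesis using N by simp
  qed
qed

text \<open>A finite run becomes an infinite play by waiting forever in its last state, which costs
  nothing.\<close>

lemma reachable_honest_play:
  assumes "(step ts)\<^sup>*\<^sup>* (3, x, 0) (s, c)"
  shows "2 \<le> s \<and> s < N \<and>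
    (\<exists>\<rho>\<in>ME. honest \<rho> \<and> (\<exists>n. (\<forall>m\<ge>n. \<rho> m = s) \<and> energy \<rho> n = (int (fst c), int (snd c))))"
  using assms
proof (induction rule: rtranclp_induct2)
  case refl
  define \<rho> :: "nat play" where "\<rho> m = (if m = 0 then 0 else 3)" for m
  have "\<rho> \<in> plays G" using edge_start edge_loop(1)[of 3] N by (auto simp: plays_def \<rho>_def)
  moreover have e: "energy \<rho> (Suc m) = (int x, 0)" for m
    using edge_start edge_loop(2)[of 3] N
    by (induction m) (simp_all add: energy_Suc energy_0, simp_all add: \<rho>_def)
  have "nonneg (energy \<rho> m)" for m
    using e by (cases m) (simp_all add: energy_0 nonneg_def)
  moreover have "honest \<rho>" using N by (auto simp: honest_def \<rho>_def)
  ultimately have "\<rho> \<in> ME" "honest \<rho>" "\<forall>m\<ge>1. \<rho> m = 3" "energy \<rho> 1 = (int x, 0)"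
    using e[of 0] by (simp_all add: ME_iff \<rho>_def)
  then show ?case using N by (auto intro!: bexI[of _ \<rho>] exI[of _ 1])
next
  case (step s c t d)
  from step.hyps(2) obtain a where a: "(s, a, t) \<in> set ts" "d \<in> ctr_sem a c" by (auto elim: step.cases)
  then obtain k where k: "k < length ts" "ts ! k = (s, a, t)" by (auto simp: in_set_conv_nth)
  have st: "3 \<le> s" "s < N" "2 \<le> t" "t < N" using ts_nth[OF k] by auto
  obtain \<rho> n where \<rho>: "\<rho> \<in> ME" "honest \<rho>" "\<forall>m\<ge>n. \<rho> m = s" "energy \<rho> n = (int (fst c), int (snd c))"
    using step.IH by blast
  \<comment> \<open>The waiting in \<open>s\<close> is cut off at time \<open>n\<close>; two moves
    through the middle state \<open>N + k\<close> execute the transition, and waiting resumes in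
    \<open>t\<close>.\<close>
  define \<rho>' where "\<rho>' m = (if m \<le> n then \<rho> m else if m = Suc n then N + k else t)" for m
  have \<rho>n: "\<rho> n = s" using \<rho>(3) by simp
  have "(\<rho>' m, \<rho>' (Suc m)) \<in> edges G" for m
  proof -
    consider "m < n" | "m = n" | "m = Suc n" | "m > Suc n" by linarith
    then show ?thesis
    proof cases
      case 1
      then show ?thesis using \<rho>(1) by (simp add: ME_iff plays_def \<rho>'_def)
    next
      case 2
      have "(s, N + k) \<in> edges G" using k edge_Add(1) edge_Test(1) by (cases a) auto
      then show ?thesis using 2 \<rho>n by (simp add: \<rho>'_def)
    next
      case 3
      then show ?thesis using edge_leave(1)[OF k] by (simp add: \<rho>'_def)
    next
      case 4
      then show ?thesis using edge_loop(1)[of t] st by (simp add: \<rho>'_def)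
    qed
  qed
  then have play: "\<rho>' \<in> plays G" using \<rho>(1) by (simp add: ME_iff plays_def) (simp add: \<rho>'_def)
  have old: "energy \<rho>' m = energy \<rho> m" if "m \<le> n" for m
    using that by (intro energy_cong) (simp add: \<rho>'_def)
  have mid: "energy \<rho>' (Suc n) = (int (fst d), int (snd d))"
  proof (cases a)
    case (Add i j)
    then show ?thesis
      using edge_Add[of k s i j t] k old[of n] \<rho>(4) a(2) \<rho>n by (simp add: energy_Suc) (simp add: \<rho>'_def)
  next
    case (Test i j)
    then show ?thesis
      using edge_Test(2)[of k s i j t] k old[of n] \<rho>(4) a(2) \<rho>n
      by (simp add: energy_Suc split: if_splits) (simp add: \<rho>'_def)
  qed
  have new: "energy \<rho>' (Suc (Suc n) + m) = (int (fst d), int (snd d))" for m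
  proof (induction m)
    case 0
    show ?case using mid edge_leave(2)[OF k] by (simp add: energy_Suc[of _ "Suc n"]) (simp add: \<rho>'_def)
  next
    case (Suc m)
    then show ?case using edge_loop(2)[of t] st by (simp add: energy_Suc) (simp add: \<rho>'_def)
  qed
  have split: "m \<le> n \<or> m = Suc n \<or> (\<exists>l. m = Suc (Suc n) + l)" for m
    by (metis le_Suc_ex not_less_eq_eq le_SucE)
  have "nonneg (energy \<rho>' m)" for m
    using split[of m] old[of m] mid new \<rho>(1) by (auto simp: ME_iff) (simp_all add: nonneg_def)
  then have "\<rho>' \<in> ME" using play by (simp add: ME_iff)
  moreover have "honest \<rho>'"
    unfolding honest_def
  proof (intro allI impI)
    fix m l u i j w assume l: "l < length ts" "ts ! l = (u, Test i j, w)" "\<rho>' m = N + l"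
    consider "m \<le> n" | "m = Suc n" | "m > Suc n" by linarith
    then show "\<not> nonneg (fst (energy \<rho>' m) + i, snd (energy \<rho>' m) + j)"
    proof cases
      case 1
      then show ?thesis using \<rho>(2) l old[of m] by (auto simp: honest_def \<rho>'_def)
    next
      case 2
      then have "l = k" using l(3) by (simp add: \<rho>'_def)
      then have "a = Test i j" using k(2) l(2) by simp
      then show ?thesis using a(2) mid 2 by (auto simp: nonneg_def split: if_splits)
    next
      case 3
      then show ?thesis using l(3) st by (simp add: \<rho>'_def)
    qed
  qed
  moreover have "\<forall>m\<ge>Suc (Suc n). \<rho>' m = t" by (simp add: \<rho>'_def)
  ultimately show ?case using new[of 0] st by auto
qed

section \<open>Solutions correspond to honest plays that reach state 2\<close>

definition solution :: "nat profile \<Rightarrow> bool" where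
  "solution \<sigma> \<longleftrightarrow> is_profile G \<sigma> \<and> outcome G \<sigma> \<in> ME \<and> (\<exists>m. outcome G \<sigma> m = 2) \<and>
    (\<forall>\<tau>. is_strategy G 2 \<tau> \<longrightarrow> outcome G (\<sigma>(2 := \<tau>)) \<in> ME \<longrightarrow> (\<exists>m. outcome G (\<sigma>(2 := \<tau>)) m = 1) \<longrightarrow>
      (\<exists>m. outcome G \<sigma> m = 1))"

text \<open>Player 1's objective is the empty set of plays, so no deviation of his is profitable and
  only the condition on player 2 remains.\<close>

lemma has_solution_iff: "has_solution (game N ts x) \<longleftrightarrow> (\<exists>\<sigma>. solution \<sigma>)"
proof -
  have d: "inst_dim (game N ts x) = 2" "inst_spec (game N ts x) = Reachability [2]"
    "inst_objs (game N ts x) = [Reachability [], Reachability [1]]"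
    by (simp_all add: game_def)
  have p: "players G = {1, 2}" by auto
  have ME: "\<rho> \<in> plays G" if "\<rho> \<in> ME" for \<rho> using that by (simp add: multi_energy_def)
  have "is_solution G 2 C (\<lambda>i. objective_set G ([Reachability [], Reachability [1]] ! (i - 1)))
      (objective_set G (Reachability [2])) \<sigma> \<longleftrightarrow> solution \<sigma>" for \<sigma>
  proof (cases "is_profile G \<sigma>")
    case True
    show ?thesis
      unfolding is_solution_def solution_def p using True ME outcome_in_plays[OF wf_G True]
      by (auto simp: reach_def)
  qed (simp add: is_solution_def solution_def)
  then show ?thesis by (simp add: has_solution_def d)
qed

text \<open>At an affordable diversion player 2 would move to state 1 and stay there, meeting her
  objective within the energy condition. The outcome itself visits the sink 2 and so never state 1,
  which makes this deviation profitable.\<close>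

lemma solution_honest:
  assumes "solution \<sigma>"
  shows "honest (outcome G \<sigma>)"
  unfolding honest_def
proof (intro allI impI notI)
  define \<rho> where "\<rho> = outcome G \<sigma>"
  fix m k u i j w
  assume k: "k < length ts" "ts ! k = (u, Test i j, w)" and m: "outcome G \<sigma> m = N + k"
    and pos: "nonneg (fst (energy (outcome G \<sigma>) m) + i, snd (energy (outcome G \<sigma>) m) + j)"
  have prof: "is_profile G \<sigma>" using assms by (simp add: solution_def)
  have ME: "\<rho> \<in> ME" using assms by (simp add: solution_def \<rho>_def)
  then have play: "\<rho> \<in> plays G" by (simp add: ME_iff)
  have fol: "follows G \<sigma> \<rho>" using follows_outcome[OF wf_G prof] by (simp add: \<rho>_def)
  \<comment> \<open>Changing the strategy at this one history suffices, as the play is in a sink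
    afterwards.\<close>
  define \<tau> where "\<tau> = (\<sigma> 2)(prefix \<rho> m := 1)"
  have \<rho>m: "\<rho> m = N + k" using m by (simp add: \<rho>_def)
  have strat: "is_strategy G 2 \<tau>"
    using prof edge_Test(3)[OF k] \<rho>m unfolding is_strategy_def is_profile_def \<tau>_def by auto
  have prof': "is_profile G (\<sigma>(2 := \<tau>))"
    using prof strat unfolding is_profile_def by auto
  define \<rho>' where "\<rho>' l = (if l \<le> m then \<rho> l else 1)" for l
  have "(\<rho>' l, \<rho>' (Suc l)) \<in> edges G" for l
  proof -
    consider "l < m" | "l = m" | "l > m" by linarith
    then show ?thesis
    proof cases
      case 1
      then show ?thesis using play by (simp add: plays_def \<rho>'_def)
    next
      case 2
      then show ?thesis using edge_Test(3)[OF k] \<rho>m by (simp add: \<rho>'_def)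
    next
      case 3
      then show ?thesis using edge_loop(1)[of 1] N by (simp add: \<rho>'_def)
    qed
  qed
  then have play': "\<rho>' \<in> plays G" using play by (simp add: plays_def) (simp add: \<rho>'_def)
  have pre: "prefix \<rho>' l = prefix \<rho> l" if "l \<le> m" for l
    using that by (intro prefix_cong) (simp add: \<rho>'_def)
  have "follows G (\<sigma>(2 := \<tau>)) \<rho>'"
    unfolding follows_def
  proof (intro allI ballI impI)
    fix l p assume p: "p \<in> players G" and c: "\<rho>' l \<in> ctrl G p"
    consider "l < m" | "l = m" | "l > m" by linarith
    then show "\<rho>' (Suc l) = (\<sigma>(2 := \<tau>)) p (prefix \<rho>' l)"
    proof cases
      case 1
      then have "prefix \<rho> l \<noteq> prefix \<rho> m" by (metis length_prefix nat.inject less_irrefl)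
      moreover have "\<rho> (Suc l) = \<sigma> p (prefix \<rho> l)"
        using fol p c 1 unfolding follows_def by (simp add: \<rho>'_def)
      ultimately show ?thesis using 1 pre[of l] by (simp add: \<rho>'_def \<tau>_def)
    next
      case 2
      then have "p = 2" using c ctrl_mid[OF k, of p] \<rho>m by (simp add: \<rho>'_def)
      then show ?thesis using 2 pre[of m] by (simp add: \<rho>'_def \<tau>_def)
    next
      case 3
      \<comment> \<open>The sink 1 belongs to player 1, whose only legal move there is the
        loop.\<close>
      then have "p = 1" using c ctrl_main[of 1 p] N by (simp add: \<rho>'_def)
      have "(\<rho>' l, \<sigma> 1 (prefix \<rho>' l)) \<in> edges G"
        using prof prefix_in_histories[OF play', of l] c \<open>p = 1\<close>
        unfolding is_profile_def is_strategy_def by fastforce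
      then have "\<sigma> 1 (prefix \<rho>' l) = 1" using edge_from_sink 3 by (simp add: \<rho>'_def)
      then show ?thesis using 3 \<open>p = 1\<close> by (simp add: \<rho>'_def)
    qed
  qed
  then have out: "outcome G (\<sigma>(2 := \<tau>)) = \<rho>'" by (rule outcome_eqI[OF wf_G prof' play'])
  have late: "energy \<rho>' (Suc m + l) = (fst (energy \<rho> m) + i, snd (energy \<rho> m) + j)" for l
  proof (induction l)
    case 0
    have "energy \<rho>' m = energy \<rho> m" by (rule energy_cong) (simp add: \<rho>'_def)
    then show ?case using edge_Test(4,5)[OF k] \<rho>m by (simp add: energy_Suc) (simp add: \<rho>'_def)
  next
    case (Suc l)
    then show ?case using edge_loop(2)[of 1] N by (simp add: energy_Suc) (simp add: \<rho>'_def)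
  qed
  have "nonneg (energy \<rho>' l)" for l
  proof (cases "l \<le> m")
    case True
    then have "energy \<rho>' l = energy \<rho> l" by (intro energy_cong) (simp add: \<rho>'_def)
    then show ?thesis using ME by (simp add: ME_iff)
  next
    case False
    then obtain l' where "l = Suc m + l'" by (metis less_imp_Suc_add not_le add_Suc)
    then show ?thesis using late pos by (simp add: \<rho>_def)
  qed
  then have "\<rho>' \<in> ME" using play' by (simp add: ME_iff)
  moreover have "\<rho>' (Suc m) = 1" by (simp add: \<rho>'_def)
  ultimately have "\<exists>l. \<rho> l = 1" using assms strat out unfolding solution_def \<rho>_def by metis
  moreover have "\<exists>l. \<rho> l = 2" using assms by (simp add: solution_def \<rho>_def)
  ultimately show False using not_both_sinks[OF play] by blast
qed

text \<open>Both players follow the honest play. If player 2 alone deviates, the first difference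
  must arise at a test, where her only other move leads to state 1; honesty says that exactly this
  step makes a resource negative.\<close>

lemma honest_solution:
  assumes "\<rho> \<in> ME" "honest \<rho>" "\<rho> n = 2"
  shows "\<exists>\<sigma>. solution \<sigma>"
proof -
  define \<sigma> :: "nat profile" where "\<sigma> i = play_strategy G \<rho>" for i
  have play: "\<rho> \<in> plays G" using assms(1) by (simp add: ME_iff)
  have prof: "is_profile G \<sigma>"
    using is_strategy_play_strategy[OF wf_G play] by (simp add: is_profile_def \<sigma>_def)
  have out: "outcome G \<sigma> = \<rho>"
    by (rule outcome_eqI[OF wf_G prof play]) (simp add: follows_def \<sigma>_def play_strategy_prefix)
  have "False" if "is_strategy G 2 \<tau>" "outcome G (\<sigma>(2 := \<tau>)) \<in> ME" "outcome G (\<sigma>(2 := \<tau>)) m = 1" for \<tau> m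
  proof -
    define \<rho>' where "\<rho>' = outcome G (\<sigma>(2 := \<tau>))"
    have prof': "is_profile G (\<sigma>(2 := \<tau>))" using prof that(1) by (simp add: is_profile_def)
    have play': "\<rho>' \<in> plays G" and fol: "follows G (\<sigma>(2 := \<tau>)) \<rho>'"
      using outcome_in_plays[OF wf_G prof'] follows_outcome[OF wf_G prof'] by (simp_all add: \<rho>'_def)
    have "\<rho> m \<noteq> 1" using not_both_sinks[OF play _ assms(3)] by blast
    then have "\<rho>' m \<noteq> \<rho> m" using that(3) by (simp add: \<rho>'_def)
    \<comment> \<open>The first moment of difference: up to it histories and energies agree, so
      honesty of the original play applies.\<close>
    define l where "l = (LEAST l. \<rho>' l \<noteq> \<rho> l)"
    have l: "\<rho>' l \<noteq> \<rho> l"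
      unfolding l_def using \<open>\<rho>' m \<noteq> \<rho> m\<close> by (rule LeastI)
    have before: "\<rho>' j = \<rho> j" if "j < l" for j
      using that not_less_Least unfolding l_def by blast
    have "\<rho>' 0 = \<rho> 0" using play play' by (simp add: plays_def)
    then obtain p where p: "l = Suc p" using l by (cases l) auto
    have pre: "prefix \<rho>' p = prefix \<rho> p" by (rule prefix_cong) (use before p in auto)
    have edge: "(\<rho> p, \<rho> (Suc p)) \<in> edges G" "(\<rho> p, \<rho>' (Suc p)) \<in> edges G"
      using play play' before[of p] p by (auto simp: plays_def) metis
    have "\<rho> p < N + length ts" using edge edge_into_states by blast
    then obtain k u i j w where k: "\<rho> p = N + k" "k < length ts" "ts ! k = (u, Test i j, w)"
    proof (cases rule: state_cases)
      case main
      then have "\<rho>' (Suc p) = \<rho> (Suc p)"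
        using fol ctrl_main[of "\<rho> p" 1] before[of p] p pre
        by (auto simp: follows_def \<sigma>_def play_strategy_prefix dest!: spec[of _ p])
      then show thesis using l p by simp
    next
      case (mid k u a w)
      show thesis
      proof (cases a)
        case (Add i j)
        then have "\<rho> p \<in> ctrl G 1" using mid ctrl_mid[OF mid(2,3)] by simp
        then have "\<rho>' (Suc p) = \<rho> (Suc p)"
          using fol before[of p] p pre
          by (auto simp: follows_def \<sigma>_def play_strategy_prefix dest!: spec[of _ p])
        then show thesis using l p by simp
      next
        case (Test i j)
        then show thesis using mid that by blast
      qed
    qed
    have "\<rho> (Suc p) \<noteq> 1" using not_both_sinks[OF play _ assms(3)] by blast
    then have "\<rho> (Suc p) = w" using edge_from_mid[OF _ k(2,3)] edge(1) k(1) by auto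
    then have "\<rho>' (Suc p) = 1" using edge_from_mid[OF _ k(2,3)] edge(2) k(1) l p by auto
    moreover have "energy \<rho>' p = energy \<rho> p" by (rule energy_cong) (use before p in auto)
    ultimately have "energy \<rho>' (Suc p) = (fst (energy \<rho> p) + i, snd (energy \<rho> p) + j)"
      using edge_Test(4,5)[OF k(2,3)] k(1) before[of p] p by (simp add: energy_Suc)
    moreover have "nonneg (energy \<rho>' (Suc p))" using that(2) by (simp add: ME_iff \<rho>'_def)
    ultimately show False using assms(2) k unfolding honest_def by metis
  qed
  then have "solution \<sigma>" using prof out assms(1,3) unfolding solution_def by metis
  then show ?thesis by blast
qed

lemma has_solution_iff_reachable:
  "has_solution (game N ts x) \<longleftrightarrow> (\<exists>c. (step ts)\<^sup>*\<^sup>* (3, x, 0) (2, c))"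
proof
  assume "has_solution (game N ts x)"
  then obtain \<sigma> m where \<sigma>: "solution \<sigma>" "outcome G \<sigma> m = 2" "outcome G \<sigma> \<in> ME"
    by (auto simp: has_solution_iff solution_def)
  show "\<exists>c. (step ts)\<^sup>*\<^sup>* (3, x, 0) (2, c)"
    using honest_play_reachable[OF \<sigma>(3) solution_honest[OF \<sigma>(1)], of m] \<sigma>(2) N by auto
next
  assume "\<exists>c. (step ts)\<^sup>*\<^sup>* (3, x, 0) (2, c)"
  then obtain c where "(step ts)\<^sup>*\<^sup>* (3, x, 0) (2, c)" ..
  then show "has_solution (game N ts x)"
    using reachable_honest_play[of 2 c] honest_solution unfolding has_solution_iff by blast
qed

end

section \<open>Diagonalisation\<close>

definition computable :: "nat \<Rightarrow> (nat list \<Rightarrow> nat) \<Rightarrow> bool" where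
  "computable n F \<longleftrightarrow> (\<exists>f. \<forall>xs. length xs = n \<longrightarrow> rec_eval f xs (F xs))"

lemma computable_comp:
  assumes "computable (length Gs) F" "\<And>G. G \<in> set Gs \<Longrightarrow> computable n G"
  shows "computable n (\<lambda>xs. F (map (\<lambda>G. G xs) Gs))"
proof -
  obtain f where f: "\<And>ys. length ys = length Gs \<Longrightarrow> rec_eval f ys (F ys)"
    using assms(1) unfolding computable_def by blast
  obtain g where g: "\<And>G xs. G \<in> set Gs \<Longrightarrow> length xs = n \<Longrightarrow> rec_eval (g G) xs (G xs)"
    using assms(2) unfolding computable_def by metis
  have "rec_eval (Comp f (map g Gs)) xs (F (map (\<lambda>G. G xs) Gs))" if "length xs = n" for xs
    using that f g by (intro rec_eval.comp[where ys = "map (\<lambda>G. G xs) Gs"]) auto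
  then show ?thesis unfolding computable_def by blast
qed

lemma computable_comp1:
  "computable 1 (\<lambda>xs. H (xs ! 0)) \<Longrightarrow> computable n F \<Longrightarrow> computable n (\<lambda>xs. H (F xs))"
  using computable_comp[of "[F]" "\<lambda>xs. H (xs ! 0)" n] by simp

lemma computable_comp2:
  "computable 2 (\<lambda>xs. H (xs ! 0) (xs ! 1)) \<Longrightarrow> computable n F \<Longrightarrow> computable n G \<Longrightarrow>
    computable n (\<lambda>xs. H (F xs) (G xs))"
  using computable_comp[of "[F, G]" "\<lambda>xs. H (xs ! 0) (xs ! 1)" n] by (auto simp: numeral_2_eq_2)

lemma computable_Suc: "computable n F \<Longrightarrow> computable n (\<lambda>xs. Suc (F xs))"
proof (rule computable_comp1[where H = Suc])
  have "rec_eval Succ xs (Suc (xs ! 0))" if "length xs = 1" for xs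
    using that by (cases xs) (auto intro: rec_eval.succ)
  then show "computable 1 (\<lambda>xs. Suc (xs ! 0))" unfolding computable_def by blast
qed

lemma computable_const: "computable n (\<lambda>_. c)"
proof (induction c)
  case 0
  show ?case unfolding computable_def using rec_eval.zero by blast
qed (rule computable_Suc)

lemma computable_nth: "i < n \<Longrightarrow> computable n (\<lambda>xs. xs ! i)"
  unfolding computable_def using rec_eval.proj by blast

lemma computable_rec_nat:
  assumes "computable n F" "computable (Suc (Suc n)) G"
  shows "computable (Suc n) (\<lambda>xs. rec_nat (F (tl xs)) (\<lambda>m r. G (m # r # tl xs)) (hd xs))"
proof -
  obtain f g where fg: "\<And>xs. length xs = n \<Longrightarrow> rec_eval f xs (F xs)"
    "\<And>xs. length xs = Suc (Suc n) \<Longrightarrow> rec_eval g xs (G xs)"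
    using assms unfolding computable_def by blast
  have "rec_eval (PrimRec f g) (m # xs) (rec_nat (F xs) (\<lambda>m r. G (m # r # xs)) m)"
    if "length xs = n" for m xs
    by (induction m) (use that fg in \<open>auto intro: rec_eval.prim_0 rec_eval.prim_Suc\<close>)
  then have "rec_eval (PrimRec f g) xs (rec_nat (F (tl xs)) (\<lambda>m r. G (m # r # tl xs)) (hd xs))"
    if "length xs = Suc n" for xs
    using that by (cases xs) auto
  then show ?thesis unfolding computable_def by blast
qed

lemma computable_cong: "(\<And>xs. length xs = n \<Longrightarrow> F xs = G xs) \<Longrightarrow> computable n F \<Longrightarrow> computable n G"
  unfolding computable_def by auto

lemma computable_binary_rec:
  assumes "computable 1 (\<lambda>xs. F (xs ! 0))" "computable 3 (\<lambda>xs. G (xs ! 0) (xs ! 1) (xs ! 2))"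
    and "\<And>y. H 0 y = F y" "\<And>m y. H (Suc m) y = G m (H m y) y"
  shows "computable 2 (\<lambda>xs. H (xs ! 0) (xs ! 1))"
proof -
  have H: "rec_nat (F y) (\<lambda>m r. G m r y) x = H x y" for x y
    by (induction x) (simp_all add: assms(3,4))
  have "computable (Suc 1) (\<lambda>xs. rec_nat (F (tl xs ! 0))
      (\<lambda>m r. G ((m # r # tl xs) ! 0) ((m # r # tl xs) ! 1) ((m # r # tl xs) ! 2)) (hd xs))"
    by (rule computable_rec_nat) (use assms(1,2) in \<open>simp_all add: numeral_3_eq_3\<close>)
  then have "computable (Suc 1) (\<lambda>xs. H (xs ! 0) (xs ! 1))"
  proof (rule computable_cong[rotated])
    fix xs :: "nat list" assume "length xs = Suc 1"
    then obtain x y where "xs = [x, y]" by (auto simp: length_Suc_conv)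
    then show "rec_nat (F (tl xs ! 0)) (\<lambda>m r. G ((m # r # tl xs) ! 0) ((m # r # tl xs) ! 1)
        ((m # r # tl xs) ! 2)) (hd xs) = H (xs ! 0) (xs ! 1)"
      by (simp add: H)
  qed
  then show ?thesis by (simp add: numeral_2_eq_2)
qed

lemma computable_add: "computable n F \<Longrightarrow> computable n G \<Longrightarrow> computable n (\<lambda>xs. F xs + G xs)"
proof (rule computable_comp2[where H = "(+)"])
  show "computable 2 (\<lambda>xs. xs ! 0 + xs ! 1)"
    by (rule computable_binary_rec[where F = "\<lambda>y. y" and G = "\<lambda>m r y. Suc r"])
      (simp_all add: computable_nth computable_Suc)
qed

lemma computable_mult: "computable n F \<Longrightarrow> computable n G \<Longrightarrow> computable n (\<lambda>xs. F xs * G xs)"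
proof (rule computable_comp2[where H = "(*)"])
  show "computable 2 (\<lambda>xs. xs ! 0 * xs ! 1)"
    by (rule computable_binary_rec[where F = "\<lambda>y. 0" and G = "\<lambda>m r y. y + r"])
      (simp_all add: computable_nth computable_const computable_add)
qed

lemma computable_power: "computable n F \<Longrightarrow> computable n (\<lambda>xs. c ^ F xs)"
\<comment> \<open>Recursion is on the first argument, so the exponent is put there.\<close>
proof (rule computable_comp2[where H = "\<lambda>x y. y ^ x"])
  show "computable 2 (\<lambda>xs. xs ! 1 ^ xs ! 0)"
    by (rule computable_binary_rec[where F = "\<lambda>y. 1" and G = "\<lambda>m r y. y * r"])
      (simp_all add: computable_nth computable_const computable_mult)
qed (auto intro: computable_const)

lemma computable_triangle:
  assumes "computable n F"
  shows "computable n (\<lambda>xs. triangle (F xs))"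
\<comment> \<open>A dummy second argument brings this unary recursion into the binary
  scheme.\<close>
proof (rule computable_comp2[where H = "\<lambda>x y. triangle x"])
  show "computable 2 (\<lambda>xs. triangle (xs ! 0))"
    by (rule computable_binary_rec[where F = "\<lambda>y. 0" and G = "\<lambda>m r y. r + Suc m"])
      (simp_all add: computable_nth computable_const computable_add computable_Suc)
qed (rule assms)+

lemma computable_prod_encode:
  "computable n F \<Longrightarrow> computable n G \<Longrightarrow> computable n (\<lambda>xs. prod_encode (F xs, G xs))"
  by (simp add: prod_encode_def computable_add computable_triangle)

text \<open>The code of the game with input \<open>(a, b)\<close>, given the codes \<open>a\<close>
  of its states and \<open>b\<close> of its edges other than the first.
  \<open>Suc (prod_encode (x, y))\<close> is the code of a list with head code \<open>x\<close> and
  tail code \<open>y\<close>; it prepends the edge that depends on the input.\<close>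

definition reduction :: "nat \<Rightarrow> nat \<Rightarrow> nat" where
  "reduction a b = list_encode [2, a, 0, 0, 2,
     Suc (prod_encode (encode_edge ((0, 3), [int (input a b), 0]), b)),
     list_encode (map encode_objective [Reachability [], Reachability [1]]),
     encode_objective (Reachability [2])]"

lemma encode_game:
  assumes "a = list_encode (map encode_state (game_states N ts))"
    and "b = list_encode (map encode_edge (game_edges N ts))"
  shows "encode_instance (game N ts (input a b)) = reduction a b"
  by (simp add: encode_instance_def game_def reduction_def assms)

lemma int_encode_int: "int_encode (int n) = 2 * n"
  by (simp add: int_encode_def sum_encode_def)

lemma computable_reduction: "computable 2 (\<lambda>xs. reduction (xs ! 0) (xs ! 1))"
  unfolding reduction_def input_def list_encode.simps encode_edge.simps list.map int_encode_int
  by (intro computable_Suc computable_prod_encode computable_mult computable_power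
      computable_const computable_nth) simp_all

lemma restricted_undecidable: "\<not> decidable_on encode_instance restricted_instances has_solution"
proof
  assume "decidable_on encode_instance restricted_instances has_solution"
  then obtain f where f: "\<And>I. I \<in> restricted_instances \<Longrightarrow>
      rec_eval f [encode_instance I] (if has_solution I then 1 else 0)"
    unfolding decidable_on_def by blast
  obtain r where r: "\<And>xs. length xs = 2 \<Longrightarrow> rec_eval r xs (reduction (xs ! 0) (xs ! 1))"
    using computable_reduction unfolding computable_def by blast
  \<comment> \<open>One program serves all inputs, so it is available before the codes of its own
    game are formed. It accepts where \<open>f\<close> answers 0, that is, denies a
    solution.\<close>
  obtain P where P: "\<And>a b. crun P (input a b, 0) \<noteq> {} \<longleftrightarrow> rec_eval (Comp f [r]) [a, b] 0"
    using counter_program[of "Comp f [r]"] by blast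
  \<comment> \<open>The automaton starts in 3 and accepts in 2, the sink of the specification. Its
    inner states begin at 4, after the four reserved numbers.\<close>
  define N where "N = 4 + fresh P"
  define ts where "ts = transitions P 3 2 4"
  define a b where "a = list_encode (map encode_state (game_states N ts))"
    and "b = list_encode (map encode_edge (game_edges N ts))"
  define I where "I = game N ts (input a b)"
  interpret counter_game N ts "input a b"
  proof
    show "3 \<le> u \<and> u < N \<and> 2 \<le> w \<and> w < N" if "(u, c, w) \<in> set ts" for u c w
      using transitions_states[of u c w P 3 2 4] that by (auto simp: ts_def N_def)
  qed (simp add: N_def)
  have "has_solution I \<longleftrightarrow> crun P (input a b, 0) \<noteq> {}"
    unfolding I_def has_solution_iff_reachable
    unfolding ts_def using transitions_sound[of P 3 2 4 "(input a b, 0)"] transitions_complete[of _ P "(input a b, 0)" 3 2 4]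
    by auto
  moreover have "rec_eval (Comp f [r]) [a, b] (if has_solution I then 1 else 0)"
    using f[OF game_restricted] r[of "[a, b]"] encode_game[OF a_def b_def]
    by (intro rec_eval.comp[where ys = "[reduction a b]"]) (auto simp: I_def)
  \<comment> \<open>\<open>I\<close> has a solution iff \<open>P\<close> accepts its input, iff
    \<open>f\<close> answers 0 on the code of \<open>I\<close>, iff \<open>I\<close> has no
    solution.\<close>
  ultimately show False
    using P[of a b] rec_eval_deterministic by (cases "has_solution I") fastforce+
qed

theorem theorem5:
  "\<not> decidable_on encode_instance instances has_solution \<and>
   \<not> decidable_on encode_instance restricted_instances has_solution"
  using restricted_undecidable unfolding decidable_on_def restricted_instances_def by blast

end
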